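(* Let $d\in\mathbb{N}=\{1,2,\dots\}$, let $f,p_1,\dots,p_m\in\mathbb{R}[X_1,\dots,X_n]_{2d}$, and let $(P)$ be the problem of minimizing $f$ over $S=\{x\in\mathbb{R}^n : p_1(x)\ge 0,\dots,p_m(x)\ge 0\}$. Suppose that $M:=M_d(y)\in\mathbb{R}^{s_d\times s_d}$ is (the moment matrix of) an optimal solution $y$ of the moment relaxation $(P_{2d})$ and that the modified moment matrix $\widetilde{M_d(y)}$ is a generalized Hankel matrix of order $d$. Then there are points $a_1,\dots,a_r\in\mathbb{R}^n$ and weights $\lambda_1>0,\dots,\lambda_r>0$ such that $$\widetilde{M_d(y)}=\sum_{i=1}^{r}\lambda_i V_d(a_i)V_d(a_i)^T,$$ where $r=\operatorname{rank} A_M$. Moreover, if $\{a_1,\dots,a_r\}\subseteq S$ and $f\in\mathbb{R}[X_1,\dots,X_n]_{2d-1}$, then $a_1,\dots,a_r$ are global minimizers of $(P)$ and $P^*=P^*_{2d}=f(a_i)$ for all $i\in\{1,\dots,r\}$.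
   Context: Notation. $n\in\mathbb{N}$, $m\in\mathbb{N}_0$; $\mathbb{R}[X_1,\dots,X_n]_k$ is the space of real polynomials of degree at most $k$; $s_k$ is its dimension and $r_k$ is the dimension of the space of forms of degree exactly $k$. $V_k$ is the column vector of all monomials of degree at most $k$, ordered by degree, and $V_k(a)\in\mathbb{R}^{s_k}$ is its evaluation at $a\in\mathbb{R}^n$. For $y=(y_\alpha)_{|\alpha|\le 2d}$ put $M_d(y):=(y_{\alpha+\beta})_{|\alpha|,|\beta|\le d}\in\mathbb{R}^{s_d\times s_d}$. A matrix in $\mathbb{R}^{s_d\times s_d}$ is a generalized Hankel matrix of order $d$ if it equals $M_d(y)$ for some $y\in\mathbb{R}^{s_{2d}}$. For $p=\sum_\gamma p_\gamma X^\gamma\in\mathbb{R}[X_1,\dots,X_n]_k$ and $d_p:=\lfloor (k-\deg p)/2\rfloor$, the localizing matrix is $M_{k,p}(y):=\big(\sum_\gamma p_\gamma y_{\alpha+\beta+\gamma}\big)_{|\alpha|,|\beta|\le d_p}$; in particular $M_{2d,1}(y)=M_d(y)$. $P^*:=\inf\{f(x):x\in S\}$; a global minimizer of $(P)$ is a point $x^*\in S$ with $f(x^* )\le f(x)$ for all $x\in S$. The moment (Lasserre) relaxation $(P_k)$ of degree $k$ (where $f,p_1,\dots,p_m$ have degree at most $k$) is: minimize $\sum_{|\alpha|\le k}f_\alpha y_\alpha$ over $y=(y_\alpha)_{|\alpha|\le k}\in\mathbb{R}^{s_k}$ subject to $y_{(0,\dots,0)}=1$, $M_{k,1}(y)\succeq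 0$, and $M_{k,p_i}(y)\succeq 0$ for $i=1,\dots,m$. Its optimal value is denoted $P^*_k$. One identifies a solution $y$ of $(P_{2d})$ with the matrix $M_d(y)$. Modified moment matrix: a positive semidefinite $M=M_d(y)$ is written in blocks, according to monomials of degree at most $d-1$ and monomials of degree exactly $d$, as $$M=\begin{pmatrix}A_M & A_MW_M\\ W_M^TA_M & C_M\end{pmatrix},$$ where $A_M\in\mathbb{R}^{s_{d-1}\times s_{d-1}}$ and $W_M\in\mathbb{R}^{s_{d-1}\times r_d}$ is some matrix for which the upper right block is $A_MW_M$ (such a matrix always exists). Then $$\widetilde{M}:=\begin{pmatrix}A_M & A_MW_M\\ W_M^TA_M & W_M^TA_MW_M\end{pmatrix},$$ which does not depend on the choice of $W_M$. *)

theory Defs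
  imports
    "HOL-Library.Poly_Mapping"
    "HOL-Library.Extended_Real"
    "HOL-Analysis.Finite_Cartesian_Product"
    "Jordan_Normal_Form.DL_Rank"
begin

text \<open>
  The variables are indexed by a finite type \<open>'n\<close>, so that \<open>n = CARD('n) \<ge> 1\<close>. A monomial
  is its exponent vector; a real polynomial is the finitely supported family of its coefficients.
\<close>

type_synonym 'n mono = "'n \<Rightarrow>\<^sub>0 nat"
type_synonym 'n rpoly = "'n mono \<Rightarrow>\<^sub>0 real"

definition mono_deg :: "'n::finite mono \<Rightarrow> nat" where
  "mono_deg \<alpha> = (\<Sum>i\<in>UNIV. Poly_Mapping.lookup \<alpha> i)"

definition mono_eval :: "'n::finite mono \<Rightarrow> real ^ 'n \<Rightarrow> real" where
  "mono_eval \<alpha> a = (\<Prod>i\<in>UNIV. vec_nth a i ^ Poly_Mapping.lookup \<alpha> i)"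

text \<open>
  The zero polynomial gets degree \<open>0\<close>. This only affects the size of its localizing matrix,
  which is zero anyway.
\<close>

definition total_deg :: "'n::finite rpoly \<Rightarrow> nat" where
  "total_deg p = (if p = 0 then 0 else Max (mono_deg ` Poly_Mapping.keys p))"

definition rpoly_eval :: "'n::finite rpoly \<Rightarrow> real ^ 'n \<Rightarrow> real" where
  "rpoly_eval p a = (\<Sum>\<alpha>\<in>Poly_Mapping.keys p. Poly_Mapping.lookup p \<alpha> * mono_eval \<alpha> a)"

text \<open>
  Monomials are ordered by degree; the order among monomials of equal degree is some fixed one.
  By construction the list of monomials of degree at most \<open>k\<close> is a prefix of the one for \<open>k + 1\<close>.
\<close>

definition forms_list :: "nat \<Rightarrow> 'n::finite mono list" where
  "forms_list j = (SOME xs. distinct xs \<and> set xs = {\<alpha>. mono_deg \<alpha> = j})"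

definition mono_list :: "nat \<Rightarrow> 'n::finite mono list" where
  "mono_list k = concat (map forms_list [0..<Suc k])"

text \<open>The dimensions \<open>s\<^sub>k\<close> and \<open>r\<^sub>k\<close>.\<close>

definition num_monos :: "'n::finite itself \<Rightarrow> nat \<Rightarrow> nat" where
  "num_monos _ k = length (mono_list k :: 'n mono list)"

definition num_forms :: "'n::finite itself \<Rightarrow> nat \<Rightarrow> nat" where
  "num_forms _ k = length (forms_list k :: 'n mono list)"

lemma finite_mono_deg_le: "finite {\<alpha> :: 'n::finite mono. mono_deg \<alpha> \<le> k}"
proof -
  have "Poly_Mapping.lookup ` {\<alpha> :: 'n mono. mono_deg \<alpha> \<le> k} \<subseteq> {f. \<forall>i. f i \<in> {..k}}"
  proof clarsimp
    fix \<alpha> :: "'n mono" and i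
    assume "mono_deg \<alpha> \<le> k"
    moreover have "Poly_Mapping.lookup \<alpha> i \<le> mono_deg \<alpha>"
      unfolding mono_deg_def by (rule member_le_sum) auto
    ultimately show "Poly_Mapping.lookup \<alpha> i \<le> k" by simp
  qed
  moreover have "finite {f :: 'n \<Rightarrow> nat. \<forall>i. f i \<in> {..k}}"
    using finite_set_of_finite_funs[of "UNIV :: 'n set" "{..k}" 0] by simp
  ultimately have "finite (Poly_Mapping.lookup ` {\<alpha> :: 'n mono. mono_deg \<alpha> \<le> k})"
    by (rule finite_subset)
  then show ?thesis
    by (rule finite_imageD) (auto intro!: inj_onI poly_mapping_eqI)
qed

lemma forms_list:
  "distinct (forms_list j :: 'n::finite mono list)"
  "set (forms_list j) = {\<alpha> :: 'n::finite mono. mono_deg \<alpha> = j}"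
proof -
  have "finite {\<alpha> :: 'n mono. mono_deg \<alpha> = j}"
    by (rule finite_subset[OF _ finite_mono_deg_le[of j]]) auto
  then have "\<exists>xs. distinct xs \<and> set xs = {\<alpha> :: 'n mono. mono_deg \<alpha> = j}"
    using finite_distinct_list by blast
  from someI_ex[OF this]
  show "distinct (forms_list j :: 'n mono list)"
    "set (forms_list j) = {\<alpha> :: 'n mono. mono_deg \<alpha> = j}"
    unfolding forms_list_def by auto
qed

lemma mono_list_Suc: "mono_list (Suc k) = mono_list k @ forms_list (Suc k)"
  by (simp add: mono_list_def)

lemma mono_list:
  "set (mono_list k) = {\<alpha> :: 'n::finite mono. mono_deg \<alpha> \<le> k}"
  "distinct (mono_list k :: 'n::finite mono list)"
proof -
  show 1: "set (mono_list k) = {\<alpha> :: 'n::finite mono. mono_deg \<alpha> \<le> k}" for k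
    by (auto simp: mono_list_def forms_list simp del: upt_Suc)
  show "distinct (mono_list k :: 'n::finite mono list)"
  proof (induction k)
    case 0
    then show ?case by (simp add: mono_list_def forms_list)
  next
    case (Suc k)
    then show ?case by (auto simp: mono_list_Suc forms_list 1)
  qed
qed

text \<open>\<open>V\<^sub>k(a)\<close>, as a matrix with a single column.\<close>

definition mono_col :: "nat \<Rightarrow> real ^ 'n::finite \<Rightarrow> real mat" where
  "mono_col k a = mat (num_monos TYPE('n) k) 1 (\<lambda>(i, _). mono_eval (mono_list k ! i) a)"

text \<open>
  A vector \<open>y\<close> indexed by the monomials of degree at most \<open>k\<close> is represented by a function on all
  monomials of which only the values at monomials of degree at most \<open>k\<close> are ever used.
\<close>

definition moment_matrix :: "nat \<Rightarrow> ('n::finite mono \<Rightarrow> real) \<Rightarrow> real mat" where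
  "moment_matrix d y = mat (num_monos TYPE('n) d) (num_monos TYPE('n) d)
     (\<lambda>(i, j). y (mono_list d ! i + mono_list d ! j))"

definition generalized_hankel :: "'n::finite itself \<Rightarrow> nat \<Rightarrow> real mat \<Rightarrow> bool" where
  "generalized_hankel _ d A \<longleftrightarrow> (\<exists>z :: 'n mono \<Rightarrow> real. A = moment_matrix d z)"

definition loc_order :: "nat \<Rightarrow> 'n::finite rpoly \<Rightarrow> nat" where
  "loc_order k p = (k - total_deg p) div 2"

definition localizing_matrix ::
  "nat \<Rightarrow> 'n::finite rpoly \<Rightarrow> ('n mono \<Rightarrow> real) \<Rightarrow> real mat" where
  "localizing_matrix k p y =
     mat (num_monos TYPE('n) (loc_order k p)) (num_monos TYPE('n) (loc_order k p))
       (\<lambda>(i, j). \<Sum>\<gamma>\<in>Poly_Mapping.keys p. Poly_Mapping.lookup p \<gamma> *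
          y (mono_list (loc_order k p) ! i + mono_list (loc_order k p) ! j + \<gamma>))"

lemma localizing_matrix_one: "localizing_matrix (2 * d) 1 y = moment_matrix d y"
proof -
  have "total_deg (1 :: 'a rpoly) = 0"
    by (simp add: total_deg_def mono_deg_def)
  then show ?thesis
    by (simp add: localizing_matrix_def moment_matrix_def loc_order_def)
qed

definition psd :: "real mat \<Rightarrow> bool" where
  "psd A \<longleftrightarrow> square_mat A \<and> transpose_mat A = A \<and>
     (\<forall>v \<in> carrier_vec (dim_row A). 0 \<le> scalar_prod v (A *\<^sub>v v))"

subsection \<open>The polynomial optimization problem and its moment relaxation\<close>

text \<open>The constraints are \<open>p 1, \<dots>, p m\<close>; for \<open>m = 0\<close> there are none.\<close>

definition feasible_set :: "nat \<Rightarrow> (nat \<Rightarrow> 'n::finite rpoly) \<Rightarrow> (real ^ 'n) set" where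
  "feasible_set m p = {x. \<forall>i\<in>{1..m}. 0 \<le> rpoly_eval (p i) x}"

definition opt_value :: "'n::finite rpoly \<Rightarrow> nat \<Rightarrow> (nat \<Rightarrow> 'n rpoly) \<Rightarrow> ereal" where
  "opt_value f m p = (INF x\<in>feasible_set m p. ereal (rpoly_eval f x))"

definition global_minimizer ::
  "'n::finite rpoly \<Rightarrow> nat \<Rightarrow> (nat \<Rightarrow> 'n rpoly) \<Rightarrow> real ^ 'n \<Rightarrow> bool" where
  "global_minimizer f m p x \<longleftrightarrow> x \<in> feasible_set m p \<and>
     (\<forall>x'\<in>feasible_set m p. rpoly_eval f x \<le> rpoly_eval f x')"

definition relax_objective ::
  "nat \<Rightarrow> 'n::finite rpoly \<Rightarrow> ('n mono \<Rightarrow> real) \<Rightarrow> real" where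
  "relax_objective k f y = (\<Sum>\<alpha> | mono_deg \<alpha> \<le> k. Poly_Mapping.lookup f \<alpha> * y \<alpha>)"

definition relax_feasible ::
  "nat \<Rightarrow> nat \<Rightarrow> (nat \<Rightarrow> 'n::finite rpoly) \<Rightarrow> ('n mono \<Rightarrow> real) \<Rightarrow> bool" where
  "relax_feasible k m p y \<longleftrightarrow> y 0 = 1 \<and> psd (localizing_matrix k 1 y) \<and>
     (\<forall>i\<in>{1..m}. psd (localizing_matrix k (p i) y))"

definition relax_opt_value ::
  "nat \<Rightarrow> 'n::finite rpoly \<Rightarrow> nat \<Rightarrow> (nat \<Rightarrow> 'n rpoly) \<Rightarrow> ereal" where
  "relax_opt_value k f m p = (INF y\<in>{y. relax_feasible k m p y}. ereal (relax_objective k f y))"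

definition relax_optimal_solution ::
  "nat \<Rightarrow> 'n::finite rpoly \<Rightarrow> nat \<Rightarrow> (nat \<Rightarrow> 'n rpoly) \<Rightarrow> ('n mono \<Rightarrow> real) \<Rightarrow> bool" where
  "relax_optimal_solution k f m p y \<longleftrightarrow> relax_feasible k m p y \<and>
     (\<forall>z. relax_feasible k m p z \<longrightarrow> relax_objective k f y \<le> relax_objective k f z)"

subsection \<open>The modified moment matrix\<close>

text \<open>
  The blocks of a matrix of order \<open>d \<ge> 1\<close>, split after the monomials of degree at most \<open>d - 1\<close>.
\<close>

definition moment_blocks ::
  "nat \<Rightarrow> ('n::finite mono \<Rightarrow> real) \<Rightarrow> real mat \<times> real mat \<times> real mat \<times> real mat" where
  "moment_blocks d y = split_block (moment_matrix d y)
     (num_monos TYPE('n) (d - 1)) (num_monos TYPE('n) (d - 1))"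

definition block_A :: "nat \<Rightarrow> ('n::finite mono \<Rightarrow> real) \<Rightarrow> real mat" where
  "block_A d y = (case moment_blocks d y of (A, B, B', C) \<Rightarrow> A)"

definition block_B :: "nat \<Rightarrow> ('n::finite mono \<Rightarrow> real) \<Rightarrow> real mat" where
  "block_B d y = (case moment_blocks d y of (A, B, B', C) \<Rightarrow> B)"

definition is_block_W :: "nat \<Rightarrow> ('n::finite mono \<Rightarrow> real) \<Rightarrow> real mat \<Rightarrow> bool" where
  "is_block_W d y W \<longleftrightarrow> W \<in> carrier_mat (num_monos TYPE('n) (d - 1)) (num_forms TYPE('n) d) \<and>
     block_B d y = block_A d y * W"

text \<open>
  If \<open>moment_matrix d y\<close> is positive semidefinite then some such \<open>W\<close> exists, and the
  following matrix does not depend on its choice (see \<open>modified_moment_matrix_eq\<close> below).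
\<close>

definition modified_moment_matrix :: "nat \<Rightarrow> ('n::finite mono \<Rightarrow> real) \<Rightarrow> real mat" where
  "modified_moment_matrix d y =
     (let A = block_A d y; W = (SOME W. is_block_W d y W)
      in four_block_mat A (A * W)
           (transpose_mat W * A) (transpose_mat W * A * W))"

lemma block_A_eq:
  assumes "d \<ge> 1"
  shows "block_A d (y :: 'n::finite mono \<Rightarrow> real) = moment_matrix (d - 1) y"
proof -
  from assms obtain e where d: "d = Suc e" by (cases d) auto
  show ?thesis
    by (rule eq_matI)
      (auto simp: block_A_def moment_blocks_def split_block_def Let_def moment_matrix_def
        num_monos_def d mono_list_Suc nth_append)
qed

lemma modified_moment_matrix_eq:
  fixes y :: "'n::finite mono \<Rightarrow> real"
  assumes d: "d \<ge> 1" and W: "is_block_W d y W"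
  shows "modified_moment_matrix d y =
    four_block_mat (block_A d y) (block_A d y * W)
      (transpose_mat W * block_A d y) (transpose_mat W * block_A d y * W)"
proof -
  let ?A = "block_A d y"
  define W' where "W' = (SOME W. is_block_W d y W)"
  have W': "is_block_W d y W'"
    unfolding W'_def using W by (rule someI)
  let ?s = "num_monos TYPE('n) (d - 1)" and ?r = "num_forms TYPE('n) d"
  have A: "?A \<in> carrier_mat ?s ?s"
    using d by (simp add: block_A_eq moment_matrix_def)
  have sym: "transpose_mat ?A = ?A"
    unfolding block_A_eq[OF d] by (rule eq_matI) (auto simp: moment_matrix_def add.commute)
  have c: "W \<in> carrier_mat ?s ?r" "W' \<in> carrier_mat ?s ?r" and eq: "?A * W = ?A * W'"
    using W W' by (auto simp: is_block_W_def)
  have tr: "transpose_mat X * ?A = transpose_mat (?A * X)" if "X \<in> carrier_mat ?s ?r" for X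
    using transpose_mult[OF A that] sym by simp
  have 1: "transpose_mat W * ?A = transpose_mat W' * ?A"
    using tr c eq by simp
  have "transpose_mat W * ?A * W = transpose_mat W * (?A * W)"
    by (rule assoc_mult_mat) (use A c in auto)
  also have "\<dots> = transpose_mat W * (?A * W')" by (simp add: eq)
  also have "\<dots> = transpose_mat W * ?A * W'"
    by (rule assoc_mult_mat[symmetric]) (use A c in auto)
  finally have "transpose_mat W * ?A * W = transpose_mat W' * ?A * W'" by (simp add: 1)
  with 1 eq show ?thesis
    by (simp add: modified_moment_matrix_def Let_def W'_def[symmetric])
qed

text \<open>\<open>\<Sum>i=1..r. \<lambda>\<^sub>i V\<^sub>d(a\<^sub>i) V\<^sub>d(a\<^sub>i)\<^sup>T\<close>.\<close>

definition atomic_matrix ::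
  "nat \<Rightarrow> nat \<Rightarrow> (nat \<Rightarrow> real) \<Rightarrow> (nat \<Rightarrow> real ^ 'n::finite) \<Rightarrow> real mat" where
  "atomic_matrix d r l a =
     finsum (module_mat TYPE(real) (num_monos TYPE('n) d) (num_monos TYPE('n) d))
       (\<lambda>i. l i \<cdot>\<^sub>m (mono_col d (a i) * transpose_mat (mono_col d (a i)))) {1..r}"

end

theory Submission
  imports Defs "HOL-Computational_Algebra.Fundamental_Theorem_Algebra"
begin

text \<open>
  Write \<open>d = e + 1\<close> and let \<open>z\<close> be the vector with \<open>M\<^sub>d(z) = modified_moment_matrix d y\<close>. It defines
  the linear functional \<open>L\<close> with \<open>L(X\<^sup>\<alpha>) = z \<alpha>\<close> (\<open>riesz z\<close>), and the matrix is the Gram matrix of the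
  form \<open>(p, q) \<mapsto> L(p q)\<close> on the polynomials of degree at most \<open>d\<close>. Let \<open>N\<close> be the radical of this
  form. The construction of the modified matrix means that the form is positive semidefinite and
  that each polynomial of degree \<open>d\<close> is congruent modulo \<open>N\<close> to one of degree at most \<open>e\<close>
  (\<open>hankel_modified_moment_matrix\<close>): the functional is flat. This is the situation of the flat
  extension theorem of Curto and Fialkow.

  On the quotient by \<open>N\<close>, which is represented by polynomials of degree at most \<open>e\<close>, multiplication
  by a variable is a well defined operator; it is symmetric, and the operators of different
  variables commute. Hence they have a common eigenvector \<open>w\<close> outside \<open>N\<close> (\<open>common_eigenvector\<close>),
  with a vector \<open>a\<close> of real eigenvalues, and \<open>L(q w) = q(a) L(w)\<close> for all \<open>q\<close> of degree at most \<open>d\<close>.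
  So evaluation at \<open>a\<close> is, up to a factor, the inner product with \<open>w\<close>. By the Cauchy-Schwarz
  inequality the largest multiple of evaluation at \<open>a\<close> that can be subtracted from \<open>L\<close>
  without losing positivity is \<open>L(w)\<^sup>2 / L(w\<^sup>2)\<close> times the evaluation. The new functional is again
  flat, and its radical gains the direction of \<open>w\<close> (\<open>deflation\<close>), so that the rank of the moment
  matrix of order \<open>e\<close> drops by exactly one (\<open>rank_moment_matrix_deflation\<close>). Induction on this rank
  yields as many atoms as the rank of \<open>A\<^sub>M\<close> (\<open>flat_functional_atomic\<close>).

  For the optimality statement, \<open>y\<close> and \<open>z\<close> agree up to degree \<open>2 d - 1\<close>, so the value of the relaxation at
  \<open>y\<close> is the average of the values \<open>f(a\<^sub>i)\<close> with weights \<open>\<lambda>\<^sub>i\<close> of total mass \<open>y 0 = 1\<close>. Each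
  point of \<open>S\<close> gives a feasible moment vector, so the optimal value is a lower bound of \<open>f\<close> on \<open>S\<close>. An
  average of numbers that are all at least as large as the average is attained by each of them
  (\<open>atoms_global_minimizers\<close>).
\<close>

section \<open>Linear functionals on polynomials\<close>

text \<open>
  The Riesz functional of the moment vector \<open>z\<close>.
\<close>

definition riesz :: "('n::finite mono \<Rightarrow> real) \<Rightarrow> 'n rpoly \<Rightarrow> real" where
  "riesz z p = (\<Sum>\<alpha>\<in>Poly_Mapping.keys p. Poly_Mapping.lookup p \<alpha> * z \<alpha>)"

abbreviation cst :: "real \<Rightarrow> 'n::finite rpoly" where
  "cst \<equiv> Poly_Mapping.single 0"

abbreviation xpow :: "'n::finite mono \<Rightarrow> 'n rpoly" where
  "xpow \<alpha> \<equiv> Poly_Mapping.single \<alpha> 1"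

definition Xvar :: "'n::finite \<Rightarrow> 'n rpoly" where
  "Xvar i = xpow (Poly_Mapping.single i 1)"

definition polys_le :: "nat \<Rightarrow> 'n::finite rpoly set" where
  "polys_le k = {p. \<forall>\<alpha>\<in>Poly_Mapping.keys p. mono_deg \<alpha> \<le> k}"

lemma riesz_superset:
  assumes "finite S" "Poly_Mapping.keys p \<subseteq> S"
  shows "riesz z p = (\<Sum>\<alpha>\<in>S. Poly_Mapping.lookup p \<alpha> * z \<alpha>)"
  unfolding riesz_def using assms
  by (intro sum.mono_neutral_left) (auto simp: in_keys_iff)

lemma riesz_zero [simp]: "riesz z 0 = 0"
  by (simp add: riesz_def)

lemma riesz_add: "riesz z (p + q) = riesz z p + riesz z q"
proof -
  let ?S = "Poly_Mapping.keys p \<union> Poly_Mapping.keys q"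
  have "Poly_Mapping.keys (p + q) \<subseteq> ?S" by (rule keys_add)
  then show ?thesis
    using riesz_superset[of ?S "p + q" z] riesz_superset[of ?S p z] riesz_superset[of ?S q z]
    by (simp add: lookup_add sum.distrib algebra_simps)
qed

lemma lookup_cst_mult: "Poly_Mapping.lookup (cst c * p) \<alpha> = c * Poly_Mapping.lookup p \<alpha>"
proof -
  have "Poly_Mapping.lookup (Poly_Mapping.map ((*) c) p) \<alpha> = c * Poly_Mapping.lookup p \<alpha>"
    by transfer (simp add: when_def)
  then show ?thesis by (simp add: mult_map_scale_conv_mult)
qed

lemma keys_cst_mult: "Poly_Mapping.keys (cst c * p) \<subseteq> Poly_Mapping.keys p"
  by (auto simp: in_keys_iff lookup_cst_mult)

lemma riesz_cst_mult: "riesz z (cst c * p) = c * riesz z p"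
  using riesz_superset[OF _ keys_cst_mult, of p z c]
  by (simp add: lookup_cst_mult riesz_def sum_distrib_left mult.assoc)

lemma riesz_diff: "riesz z (p - q) = riesz z p - riesz z q"
  using riesz_add[of z "p - q" q] by simp

lemma riesz_sum: "riesz z (\<Sum>i\<in>I. f i) = (\<Sum>i\<in>I. riesz z (f i))"
  by (induction I rule: infinite_finite_induct) (auto simp: riesz_add)

lemma riesz_xpow [simp]: "riesz z (xpow \<alpha>) = z \<alpha>"
  by (simp add: riesz_def)

lemma cst_mult_xpow: "cst c * xpow \<alpha> = Poly_Mapping.single \<alpha> c"
  by (simp add: mult_single)

lemma cst_add: "cst (a + b) = cst a + cst b"
  by (simp add: single_add)

lemma cst_mult: "cst (a * b) = cst a * cst b"
  by (simp add: mult_single)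

lemma rpoly_expand:
  assumes "finite S" "Poly_Mapping.keys p \<subseteq> S"
  shows "p = (\<Sum>\<alpha>\<in>S. cst (Poly_Mapping.lookup p \<alpha>) * xpow \<alpha>)"
proof (rule poly_mapping_eqI)
  fix \<beta>
  have "(\<Sum>\<alpha>\<in>S. Poly_Mapping.lookup (Poly_Mapping.single \<alpha> (Poly_Mapping.lookup p \<alpha>)) \<beta>)
    = (\<Sum>\<alpha>\<in>S. if \<alpha> = \<beta> then Poly_Mapping.lookup p \<alpha> else 0)"
    by (rule sum.cong) (auto simp: lookup_single when_def)
  also have "\<dots> = Poly_Mapping.lookup p \<beta>"
    using assms by (auto simp: in_keys_iff)
  finally show "Poly_Mapping.lookup p \<beta> =
      Poly_Mapping.lookup (\<Sum>\<alpha>\<in>S. cst (Poly_Mapping.lookup p \<alpha>) * xpow \<alpha>) \<beta>"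
    by (simp add: lookup_sum cst_mult_xpow)
qed

lemma mono_deg_add [simp]: "mono_deg (\<alpha> + \<beta>) = mono_deg \<alpha> + mono_deg \<beta>"
  by (simp add: mono_deg_def lookup_add sum.distrib)

lemma mono_deg_zero [simp]: "mono_deg 0 = 0"
  by (simp add: mono_deg_def)

lemma mono_deg_single [simp]: "mono_deg (Poly_Mapping.single i k) = k"
  by (simp add: mono_deg_def lookup_single when_def)

lemma mono_eval_add: "mono_eval (\<alpha> + \<beta>) a = mono_eval \<alpha> a * mono_eval \<beta> a"
  by (simp add: mono_eval_def lookup_add power_add prod.distrib)

lemma mono_eval_zero [simp]: "mono_eval 0 a = 1"
  by (simp add: mono_eval_def)

lemma mono_eval_single: "mono_eval (Poly_Mapping.single i 1) a = vec_nth a i"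
proof -
  have "(\<Prod>j\<in>UNIV. vec_nth a j ^ Poly_Mapping.lookup (Poly_Mapping.single i (1::nat)) j)
      = (\<Prod>j\<in>UNIV. if j = i then vec_nth a j else 1)"
    by (rule prod.cong) (auto simp: lookup_single when_def)
  then show ?thesis by (simp add: mono_eval_def)
qed

lemma rpoly_eval_eq_riesz: "rpoly_eval p a = riesz (\<lambda>\<alpha>. mono_eval \<alpha> a) p"
  by (simp add: rpoly_eval_def riesz_def)

lemma riesz_mult_expand:
  assumes "finite S" "Poly_Mapping.keys p \<subseteq> S" "finite T" "Poly_Mapping.keys q \<subseteq> T"
  shows "riesz z (p * q) =
    (\<Sum>\<alpha>\<in>S. \<Sum>\<beta>\<in>T. Poly_Mapping.lookup p \<alpha> * Poly_Mapping.lookup q \<beta> * z (\<alpha> + \<beta>))"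
proof -
  have "p * q = (\<Sum>\<alpha>\<in>S. \<Sum>\<beta>\<in>T.
      cst (Poly_Mapping.lookup p \<alpha> * Poly_Mapping.lookup q \<beta>) * xpow (\<alpha> + \<beta>))"
    by (subst rpoly_expand[OF assms(1,2)], subst rpoly_expand[OF assms(3,4)])
      (simp add: sum_product mult_single)
  then show ?thesis by (simp only: riesz_sum riesz_cst_mult riesz_xpow)
qed

lemma riesz_mult_expand_right:
  "riesz z (p * g) =
    (\<Sum>\<alpha>\<in>Poly_Mapping.keys g. Poly_Mapping.lookup g \<alpha> * riesz z (p * xpow \<alpha>))"
proof -
  have "p * g = (\<Sum>\<alpha>\<in>Poly_Mapping.keys g. p * (cst (Poly_Mapping.lookup g \<alpha>) * xpow \<alpha>))"
    by (subst rpoly_expand[of "Poly_Mapping.keys g" g]) (simp_all add: sum_distrib_left)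
  then show ?thesis by (simp only: riesz_sum mult.left_commute[of p] riesz_cst_mult)
qed

lemma rpoly_eval_mult: "rpoly_eval (p * q) a = rpoly_eval p a * rpoly_eval q a"
proof -
  have "rpoly_eval (p * q) a = (\<Sum>\<alpha>\<in>Poly_Mapping.keys p. \<Sum>\<beta>\<in>Poly_Mapping.keys q.
      Poly_Mapping.lookup p \<alpha> * Poly_Mapping.lookup q \<beta> * mono_eval (\<alpha> + \<beta>) a)"
    unfolding rpoly_eval_eq_riesz by (rule riesz_mult_expand) auto
  then show ?thesis
    by (simp add: rpoly_eval_def sum_product mono_eval_add mult_ac)
qed

lemma lookup_polys_le: "p \<in> polys_le k \<Longrightarrow> k < mono_deg \<alpha> \<Longrightarrow> Poly_Mapping.lookup p \<alpha> = 0"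
  using not_in_keys_iff_lookup_eq_zero[of \<alpha> p] by (auto simp: polys_le_def)

lemma polys_le_zero [simp]: "0 \<in> polys_le k"
  by (simp add: polys_le_def)

lemma polys_le_add: "p \<in> polys_le k \<Longrightarrow> q \<in> polys_le k \<Longrightarrow> p + q \<in> polys_le k"
  using keys_add[of p q] by (auto simp: polys_le_def)

lemma polys_le_cst_mult: "p \<in> polys_le k \<Longrightarrow> cst c * p \<in> polys_le k"
  using keys_cst_mult[of c p] by (auto simp: polys_le_def)

lemma polys_le_uminus: "p \<in> polys_le k \<Longrightarrow> - p \<in> polys_le k"
  by (auto simp: polys_le_def in_keys_iff)

lemma polys_le_diff: "p \<in> polys_le k \<Longrightarrow> q \<in> polys_le k \<Longrightarrow> p - q \<in> polys_le k"
  using polys_le_add[of p k "- q"] polys_le_uminus[of q k] by simp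

lemma polys_le_sum: "(\<And>i. i \<in> I \<Longrightarrow> f i \<in> polys_le k) \<Longrightarrow> (\<Sum>i\<in>I. f i) \<in> polys_le k"
  by (induction I rule: infinite_finite_induct) (auto intro: polys_le_add)

lemma polys_le_mono: "p \<in> polys_le k \<Longrightarrow> k \<le> l \<Longrightarrow> p \<in> polys_le l"
  by (force simp: polys_le_def)

lemma polys_le_SucI: "p \<in> polys_le k \<Longrightarrow> p \<in> polys_le (Suc k)"
  by (rule polys_le_mono) auto

lemma polys_le_xpow: "mono_deg \<alpha> \<le> k \<Longrightarrow> xpow \<alpha> \<in> polys_le k"
  by (simp add: polys_le_def)

lemma polys_le_mult:
  assumes "p \<in> polys_le k" "q \<in> polys_le l"
  shows "p * q \<in> polys_le (k + l)"
  unfolding polys_le_def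
proof clarify
  fix \<gamma> assume "\<gamma> \<in> Poly_Mapping.keys (p * q)"
  then obtain \<alpha> \<beta> where "\<gamma> = \<alpha> + \<beta>" "\<alpha> \<in> Poly_Mapping.keys p" "\<beta> \<in> Poly_Mapping.keys q"
    using keys_mult[of p q] by auto
  with assms show "mono_deg \<gamma> \<le> k + l" by (auto simp: polys_le_def intro: add_mono)
qed

lemma polys_le_Xvar_mult: "p \<in> polys_le k \<Longrightarrow> Xvar i * p \<in> polys_le (Suc k)"
  using polys_le_mult[of "Xvar i" 1 p k] polys_le_xpow[of "Poly_Mapping.single i 1" 1]
  by (simp add: Xvar_def)

lemma mono_split_var:
  assumes "mono_deg \<alpha> \<noteq> 0"
  obtains i \<beta> where "\<alpha> = Poly_Mapping.single i 1 + \<beta>"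
proof -
  have "\<exists>i. Poly_Mapping.lookup \<alpha> i \<noteq> 0"
  proof (rule ccontr)
    assume "\<not> ?thesis"
    then show False using assms by (simp add: mono_deg_def)
  qed
  then obtain i where i: "Poly_Mapping.lookup \<alpha> i \<noteq> 0" by blast
  have "\<alpha> = Poly_Mapping.single i 1 + (\<alpha> - Poly_Mapping.single i 1)"
    by (rule poly_mapping_eqI) (use i in \<open>auto simp: lookup_add lookup_minus lookup_single when_def\<close>)
  then show thesis by (rule that)
qed

text \<open>
  Every monomial of degree at most \<open>2 d\<close> therefore occurs as an index sum in a moment matrix of order \<open>d\<close>:
  the variables are moved one at a time from \<open>\<alpha>\<close> to the first factor.
\<close>

lemma mono_split_deg:
  assumes "mono_deg \<alpha> \<le> j + k"
  shows "\<exists>\<beta> \<gamma>. \<alpha> = \<beta> + \<gamma> \<and> mono_deg \<beta> \<le> j \<and> mono_deg \<gamma> \<le> k"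
  using assms
proof (induction j arbitrary: \<alpha>)
  case 0
  then show ?case by (intro exI[of _ 0] exI[of _ \<alpha>]) simp
next
  case (Suc j)
  show ?case
  proof (cases "mono_deg \<alpha> = 0")
    case True
    then show ?thesis by (intro exI[of _ 0] exI[of _ \<alpha>]) simp
  next
    case False
    then obtain i \<alpha>' where \<alpha>: "\<alpha> = Poly_Mapping.single i 1 + \<alpha>'" by (rule mono_split_var)
    then have "mono_deg \<alpha>' \<le> j + k" using Suc.prems by simp
    then obtain \<beta> \<gamma> where "\<alpha>' = \<beta> + \<gamma>" "mono_deg \<beta> \<le> j" "mono_deg \<gamma> \<le> k"
      using Suc.IH by blast
    then show ?thesis
      by (intro exI[of _ "Poly_Mapping.single i 1 + \<beta>"] exI[of _ \<gamma>]) (simp add: \<alpha> add.assoc)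
  qed
qed

text \<open>
  Gaussian elimination: a vector with a nonzero entry at \<open>s\<close> is used to clear this entry in all the
  others, which are then dependent by induction. A relation among them lifts to the original vectors.
\<close>

lemma linear_dependence:
  fixes f :: "'i \<Rightarrow> 's \<Rightarrow> real"
  assumes "finite S" "finite I" "card S < card I"
  shows "\<exists>c. (\<exists>i\<in>I. c i \<noteq> 0) \<and> (\<forall>s\<in>S. (\<Sum>i\<in>I. c i * f i s) = 0)"
  using assms
proof (induction S arbitrary: I f rule: finite_induct)
  case empty
  then show ?case by (intro exI[of _ "\<lambda>_. 1"]) (auto simp: card_gt_0_iff)
next
  case (insert s S)
  show ?case
  proof (cases "\<exists>j\<in>I. f j s \<noteq> 0")
    case False
    have "card S < card I" using insert by simp
    then obtain c where "\<exists>i\<in>I. c i \<noteq> 0" "\<forall>s\<in>S. (\<Sum>i\<in>I. c i * f i s) = 0"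
      using insert.IH[of I f] insert.prems by blast
    with False show ?thesis by (intro exI[of _ c]) auto
  next
    case True
    then obtain j where j: "j \<in> I" "f j s \<noteq> 0" by blast
    define g where "g i t = f i t - f i s / f j s * f j t" for i t
    have "card S < card (I - {j})" using insert j by simp
    then obtain c where c: "\<exists>i\<in>I - {j}. c i \<noteq> 0"
        "\<forall>t\<in>S. (\<Sum>i\<in>I - {j}. c i * g i t) = 0"
      using insert.IH[of "I - {j}" g] insert.prems by blast
    \<comment> \<open>The coefficient of the pivot vector undoes the elimination.\<close>
    define b where "b = c(j := - (\<Sum>i\<in>I - {j}. c i * (f i s / f j s)))"
    have eq: "(\<Sum>i\<in>I. b i * f i t) = (\<Sum>i\<in>I - {j}. c i * g i t)" for t
    proof -
      have "(\<Sum>i\<in>I. b i * f i t) = b j * f j t + (\<Sum>i\<in>I - {j}. b i * f i t)"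
        using j insert.prems by (simp add: sum.remove)
      also have "(\<Sum>i\<in>I - {j}. b i * f i t) = (\<Sum>i\<in>I - {j}. c i * f i t)"
        by (rule sum.cong) (auto simp: b_def)
      finally show ?thesis
        by (simp add: b_def g_def algebra_simps sum_subtractf sum_distrib_left)
    qed
    have "(\<Sum>i\<in>I - {j}. c i * g i s) = 0" by (simp add: g_def j)
    with c eq have "\<forall>t\<in>insert s S. (\<Sum>i\<in>I. b i * f i t) = 0" by auto
    moreover have "\<exists>i\<in>I. b i \<noteq> 0" using c(1) by (auto simp: b_def)
    ultimately show ?thesis by blast
  qed
qed

section \<open>Factors of real polynomials\<close>

lemma map_poly_of_real_mult:
  "map_poly complex_of_real (p * q) = map_poly complex_of_real p * map_poly complex_of_real q"
  by (intro poly_eqI) (simp add: coeff_map_poly coeff_mult)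

lemma map_poly_of_real_add:
  "map_poly complex_of_real (p + q) = map_poly complex_of_real p + map_poly complex_of_real q"
  by (intro poly_eqI) (simp add: coeff_map_poly)

text \<open>
  A nonreal complex root \<open>a + b \<i>\<close> gives the quadratic factor, because the remainder of \<open>q\<close> modulo this
  quadratic is a linear real polynomial that vanishes at a nonreal point. The quadratic is \<open>(x - a)\<^sup>2 + b\<^sup>2\<close>;
  this form is what positivity is applied to later.
\<close>

lemma real_poly_factor:
  fixes q :: "real poly"
  assumes "degree q \<noteq> 0"
  shows "(\<exists>c q'. q = [:-c, 1:] * q') \<or> (\<exists>a b q'. b \<noteq> 0 \<and> q = [:a\<^sup>2 + b\<^sup>2, -2 * a, 1:] * q')"
proof -
  let ?ev = "\<lambda>p \<zeta>. poly (map_poly complex_of_real p) \<zeta>"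
  have "\<not> constant (?ev q)" using assms by (simp add: constant_degree degree_map_poly)
  then obtain \<zeta> where \<zeta>: "?ev q \<zeta> = 0" using fundamental_theorem_of_algebra by blast
  let ?a = "Re \<zeta>" and ?b = "Im \<zeta>"
  show ?thesis
  proof (cases "?b = 0")
    case True
    then have "\<zeta> = complex_of_real ?a" by (simp add: complex_eq_iff)
    moreover have "?ev q (complex_of_real x) = complex_of_real (poly q x)" for x
      by (simp add: poly_altdef coeff_map_poly degree_map_poly)
    ultimately have "complex_of_real (poly q ?a) = 0" using \<zeta> by metis
    then have "[:-?a, 1:] dvd q" by (simp add: poly_eq_0_iff_dvd)
    then show ?thesis by (auto simp: dvd_def)
  next
    case False
    let ?s = "[:?a\<^sup>2 + ?b\<^sup>2, -2 * ?a, 1:]"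
    define r where "r = q mod ?s"
    have "degree r < 2"
      using degree_mod_less[of ?s q] by (auto simp: r_def)
    then have r: "r = [:coeff r 0, coeff r 1:]"
      by (intro poly_eqI) (auto simp: coeff_pCons coeff_eq_0 split: nat.splits)
    have s0: "?ev ?s \<zeta> = 0"
      by (simp add: map_poly_pCons complex_eq_iff power2_eq_square algebra_simps)
    have "q = ?s * (q div ?s) + r" unfolding r_def by (rule mult_div_mod_eq[symmetric])
    then have "?ev q \<zeta> = ?ev ?s \<zeta> * ?ev (q div ?s) \<zeta> + ?ev r \<zeta>"
      by (metis map_poly_of_real_add map_poly_of_real_mult poly_add poly_mult)
    with \<zeta> s0 have "?ev r \<zeta> = 0" by simp
    then have "?ev [:coeff r 0, coeff r 1:] \<zeta> = 0" using r by simp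
    with False have "coeff r 1 = 0" "coeff r 0 = 0"
      by (auto simp: map_poly_pCons complex_eq_iff)
    then have "r = 0" using r by simp
    then have "q = ?s * (q div ?s)" using \<open>q = ?s * (q div ?s) + r\<close> by simp
    with False show ?thesis by blast
  qed
qed

section \<open>Positive functionals and their radicals\<close>

definition positive_on :: "nat \<Rightarrow> ('n::finite mono \<Rightarrow> real) \<Rightarrow> bool" where
  "positive_on d z \<longleftrightarrow> (\<forall>p\<in>polys_le d. 0 \<le> riesz z (p * p))"

text \<open>
  The radical of the bilinear form \<open>(p, q) \<mapsto> L(p q)\<close>, that is, the kernel of the moment matrix of order \<open>d\<close>.
\<close>

definition null_space :: "nat \<Rightarrow> ('n::finite mono \<Rightarrow> real) \<Rightarrow> 'n rpoly set" where
  "null_space d z = {p \<in> polys_le d. \<forall>q\<in>polys_le d. riesz z (p * q) = 0}"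

lemma cauchy_schwarz:
  assumes "positive_on d z" "p \<in> polys_le d" "q \<in> polys_le d"
  shows "(riesz z (p * q))\<^sup>2 \<le> riesz z (p * p) * riesz z (q * q)"
proof -
  have ex: "0 \<le> riesz z (p * p) + 2 * t * riesz z (p * q) + t\<^sup>2 * riesz z (q * q)" for t
  proof -
    have "(p + cst t * q) * (p + cst t * q)
        = p * p + cst (2 * t) * (p * q) + cst (t\<^sup>2) * (q * q)"
    proof -
      have 2: "cst (2 * t) = cst t + cst t" and sq: "cst (t\<^sup>2) = cst t * cst t"
        by (simp_all add: single_add[symmetric] mult_single power2_eq_square)
      show ?thesis unfolding 2 sq by (simp only: algebra_simps)
    qed
    moreover have "0 \<le> riesz z ((p + cst t * q) * (p + cst t * q))"
      using assms by (auto simp: positive_on_def intro: polys_le_add polys_le_cst_mult)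
    ultimately show ?thesis by (simp add: riesz_add riesz_cst_mult)
  qed
  show ?thesis
  proof (cases "riesz z (q * q) = 0")
    case True
    have "riesz z (p * q) = 0"
    proof (rule ccontr)
      assume "riesz z (p * q) \<noteq> 0"
      then show False
        \<comment> \<open>This parameter makes the affine function of \<open>t\<close> equal to \<open>-1\<close>.\<close>
        using ex[of "- (riesz z (p * p) + 1) / (2 * riesz z (p * q))"] True
        by (simp add: field_simps)
    qed
    with True show ?thesis by simp
  next
    case False
    moreover have "0 \<le> riesz z (q * q)" using assms by (auto simp: positive_on_def)
    ultimately have C: "0 < riesz z (q * q)" by simp
    show ?thesis
      \<comment> \<open>The minimum of the quadratic function of \<open>t\<close>.\<close>
      using ex[of "- riesz z (p * q) / riesz z (q * q)"] C
      by (simp add: field_simps power2_eq_square)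
  qed
qed

lemma null_spaceI:
  assumes "positive_on d z" "p \<in> polys_le d" "riesz z (p * p) = 0"
  shows "p \<in> null_space d z"
  unfolding null_space_def using assms cauchy_schwarz[OF assms(1,2)] by auto

lemma null_space_polys_le: "p \<in> null_space d z \<Longrightarrow> p \<in> polys_le d"
  by (simp add: null_space_def)

lemma null_space_mult: "p \<in> null_space d z \<Longrightarrow> q \<in> polys_le d \<Longrightarrow> riesz z (p * q) = 0"
  by (simp add: null_space_def)

lemma null_space_zero [simp]: "0 \<in> null_space d z"
  by (simp add: null_space_def)

lemma null_space_add: "p \<in> null_space d z \<Longrightarrow> q \<in> null_space d z \<Longrightarrow> p + q \<in> null_space d z"
  by (simp add: null_space_def polys_le_add distrib_right riesz_add)

lemma null_space_cst_mult: "p \<in> null_space d z \<Longrightarrow> cst c * p \<in> null_space d z"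
  by (simp add: null_space_def polys_le_cst_mult mult.assoc riesz_cst_mult)

lemma null_space_sum:
  "(\<And>i. i \<in> I \<Longrightarrow> f i \<in> null_space d z) \<Longrightarrow> (\<Sum>i\<in>I. f i) \<in> null_space d z"
  by (induction I rule: infinite_finite_induct) (auto intro: null_space_add)

lemma null_space_pos:
  assumes "positive_on d z" "p \<in> polys_le d" "p \<notin> null_space d z"
  shows "0 < riesz z (p * p)"
proof -
  have "0 \<le> riesz z (p * p)" using assms by (auto simp: positive_on_def)
  with null_spaceI[OF assms(1,2)] assms(3) show ?thesis by fastforce
qed

section \<open>Flat functionals and multiplication operators\<close>

text \<open>
  Modulo the radical, degree \<open>e\<close> already represents everything of degree \<open>e + 1\<close>. This is what makes
  multiplication by a variable an operator: it raises the degree to at most \<open>e + 1\<close>, and flatness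
  brings it back to \<open>e\<close>.
\<close>

locale flat_functional =
  fixes e :: nat and z :: "'n::finite mono \<Rightarrow> real"
  assumes positive: "positive_on (Suc e) z"
    and flat: "p \<in> polys_le (Suc e) \<Longrightarrow> \<exists>p'\<in>polys_le e. p - p' \<in> null_space (Suc e) z"
begin

abbreviation "N \<equiv> null_space (Suc e) z"
abbreviation "L \<equiv> riesz z"

text \<open>
  By flatness, orthogonality to degree \<open>e\<close> is enough: a test polynomial of degree \<open>e + 1\<close> differs from one
  of degree \<open>e\<close> by an element of the radical.
\<close>

lemma null_space_test:
  assumes "p \<in> polys_le (Suc e)" "\<And>g. g \<in> polys_le e \<Longrightarrow> L (p * g) = 0"
  shows "p \<in> N"
proof -
  have "L (p * q) = 0" if q: "q \<in> polys_le (Suc e)" for q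
  proof -
    obtain q' where q': "q' \<in> polys_le e" "q - q' \<in> N" using flat[OF q] by blast
    have "L (p * q) = L (p * q') + L ((q - q') * p)"
      by (simp add: riesz_add[symmetric] algebra_simps)
    also have "\<dots> = 0" using q' assms null_space_mult by simp
    finally show ?thesis .
  qed
  with assms show ?thesis by (simp add: null_space_def)
qed

text \<open>
  Here \<open>p'\<close> and \<open>q'\<close> are representatives of \<open>X\<^sub>j p\<close> and \<open>X\<^sub>j q\<close>. Both sides equal \<open>L(X\<^sub>j p q)\<close>.
\<close>

lemma multiplication_symmetric:
  assumes p: "p \<in> polys_le e" "p' \<in> polys_le (Suc e)" "Xvar j * p - p' \<in> N"
      and q: "q \<in> polys_le e" "q' \<in> polys_le (Suc e)" "Xvar j * q - q' \<in> N"
  shows "L (p' * q) = L (p * q')"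
proof -
  have "L ((Xvar j * p - p') * q) = 0" "L ((Xvar j * q - q') * p) = 0"
    using p q by (auto intro!: null_space_mult polys_le_SucI)
  then have "L (Xvar j * p * q) = L (p' * q)" "L (Xvar j * q * p) = L (q' * p)"
    by (simp_all add: left_diff_distrib riesz_diff)
  then show ?thesis by (simp add: mult_ac)
qed

text \<open>
  The spectral theorem for a single operator, in algebraic form. Let \<open>q\<close> be a nonzero real polynomial of
  least degree that annihilates \<open>v\<close> modulo \<open>N\<close> when \<open>X\<^sub>j\<close> is substituted; one exists because degree \<open>e\<close> is
  finite dimensional. If \<open>q = (x - c) q'\<close>, then \<open>q'\<close> applied to \<open>v\<close> is an eigenvector, and minimality keeps it
  outside \<open>N\<close>. If \<open>q = ((x - a)\<^sup>2 + b\<^sup>2) q'\<close> and \<open>w\<close> is the result of applying \<open>q'\<close> to \<open>v\<close>, then by symmetry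
  \<open>0 = L(((X\<^sub>j - a) w)\<^sup>2) + b\<^sup>2 L(w\<^sup>2)\<close>, which is impossible because the last summand is positive.
  
  Multiplication is defined only up to \<open>N\<close>, so the powers of the operator are replaced by a sequence \<open>u\<close> of
  representatives of \<open>X\<^sub>j\<^sup>k v\<close> in \<open>E\<close>, and \<open>U q\<close> is the result of applying the polynomial \<open>q\<close> to \<open>v\<close>.
\<close>

lemma eigenvector_in_stable_subspace:
  assumes E: "E \<subseteq> polys_le e"
    and add: "\<And>p q. p \<in> E \<Longrightarrow> q \<in> E \<Longrightarrow> p + q \<in> E"
    and cmult: "\<And>c p. p \<in> E \<Longrightarrow> cst c * p \<in> E"
    and stable: "\<And>p. p \<in> E \<Longrightarrow> \<exists>p'\<in>E. Xvar j * p - p' \<in> N"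
    and v: "v \<in> E" "v \<notin> N"
  shows "\<exists>c. \<exists>w\<in>E. w \<notin> N \<and> Xvar j * w - cst c * w \<in> N"
proof -
  have "\<exists>u. u 0 = v \<and> (\<forall>k. u k \<in> E \<and> Xvar j * u k - u (Suc k) \<in> N)"
  proof -
    define nxt where "nxt p = (SOME p'. p' \<in> E \<and> Xvar j * p - p' \<in> N)" for p
    have nxt: "nxt p \<in> E \<and> Xvar j * p - nxt p \<in> N" if "p \<in> E" for p
      unfolding nxt_def by (rule someI_ex) (use stable[OF that] in blast)
    have "(nxt ^^ k) v \<in> E" for k by (induction k) (auto simp: v nxt)
    then show ?thesis by (intro exI[of _ "\<lambda>k. (nxt ^^ k) v"]) (auto simp: nxt)
  qed
  then obtain u where u0: "u 0 = v" and uE: "\<And>k. u k \<in> E"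
    and u_Suc: "\<And>k. Xvar j * u k - u (Suc k) \<in> N" by blast
  define U where "U q = (\<Sum>k\<le>degree q. cst (coeff q k) * u k)" for q :: "real poly"
  have U_eq: "U q = (\<Sum>k\<le>K. cst (coeff q k) * u k)" if "degree q \<le> K" for q K
    unfolding U_def using that
    by (intro sum.mono_neutral_left) (auto simp: coeff_eq_0)
  have U_add: "U (q + q') = U q + U q'" for q q'
  proof -
    let ?K = "max (degree q) (degree q')"
    have "degree (q + q') \<le> ?K" by (rule degree_add_le) auto
    then show ?thesis
      using U_eq[of "q + q'" ?K] U_eq[of q ?K] U_eq[of q' ?K]
      by (simp add: cst_add distrib_right sum.distrib)
  qed
  have U_smult: "U (Polynomial.smult c q) = cst c * U q" for c q
    using U_eq[of "Polynomial.smult c q" "degree q"]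
    by (simp add: U_def sum_distrib_left cst_mult mult.assoc)
  have E0: "0 \<in> E" using cmult[OF v(1), of 0] by simp
  have E_sum: "(\<And>i. i \<in> I \<Longrightarrow> f i \<in> E) \<Longrightarrow> sum f I \<in> E" for f and I :: "nat set"
    by (induction I rule: infinite_finite_induct) (auto intro: add E0)
  have UE: "U q \<in> E" for q unfolding U_def by (intro E_sum cmult uE)
  have U_pCons: "Xvar j * U q - U (pCons 0 q) \<in> N" for q
  proof -
    have "U (pCons 0 q) = (\<Sum>k\<le>Suc (degree q). cst (coeff (pCons 0 q) k) * u k)"
      by (rule U_eq) (simp add: degree_pCons_le)
    also have "\<dots> = (\<Sum>k\<le>degree q. cst (coeff q k) * u (Suc k))"
      by (subst sum.atMost_Suc_shift) simp
    finally have "Xvar j * U q - U (pCons 0 q)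
        = (\<Sum>k\<le>degree q. cst (coeff q k) * (Xvar j * u k - u (Suc k)))"
      by (simp add: U_def sum_distrib_left sum_subtractf right_diff_distrib mult.left_commute)
    then show ?thesis by (simp add: null_space_sum null_space_cst_mult u_Suc)
  qed
  have U_linear: "Xvar j * U q - (cst c * U q + U ([:-c, 1:] * q)) \<in> N" for c q
  proof -
    have "[:-c, 1:] * q = Polynomial.smult (-c) q + pCons 0 q" by simp
    then have "cst c * U q + U ([:-c, 1:] * q) = U (pCons 0 q)"
      by (simp only: U_add U_smult) (simp add: single_uminus)
    then show ?thesis using U_pCons by simp
  qed
  have "\<exists>q. q \<noteq> 0 \<and> U q \<in> N"
  proof -
    let ?S = "{\<alpha> :: 'n mono. mono_deg \<alpha> \<le> e}"
    have "\<exists>c. (\<exists>k\<in>{..card ?S}. c k \<noteq> 0) \<and>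
        (\<forall>\<alpha>\<in>?S. (\<Sum>k\<in>{..card ?S}. c k * Poly_Mapping.lookup (u k) \<alpha>) = 0)"
      by (rule linear_dependence) (auto simp: finite_mono_deg_le)
    then obtain c k0 where c: "k0 \<le> card ?S" "c k0 \<noteq> 0"
      "\<And>\<alpha>. \<alpha> \<in> ?S \<Longrightarrow> (\<Sum>k\<le>card ?S. c k * Poly_Mapping.lookup (u k) \<alpha>) = 0" by auto
    define q where "q = (\<Sum>k\<le>card ?S. Polynomial.monom (c k) k)"
    have cq: "coeff q k = (if k \<le> card ?S then c k else 0)" for k
      by (simp add: q_def coeff_sum)
    have "q \<noteq> 0" using c cq[of k0] by auto
    moreover have "U q = 0"
    proof (rule poly_mapping_eqI)
      fix \<alpha>
      have "degree q \<le> card ?S" by (rule degree_le) (simp add: cq)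
      then have "Poly_Mapping.lookup (U q) \<alpha> = (\<Sum>k\<le>card ?S. c k * Poly_Mapping.lookup (u k) \<alpha>)"
        by (simp add: U_eq lookup_sum lookup_cst_mult cq)
      also have "\<dots> = 0"
      proof (cases "\<alpha> \<in> ?S")
        case False
        have "u k \<in> polys_le e" for k using uE E by blast
        with False have "Poly_Mapping.lookup (u k) \<alpha> = 0" for k
          using lookup_polys_le[of "u k" e \<alpha>] by simp
        then show ?thesis by simp
      qed (use c in simp)
      finally show "Poly_Mapping.lookup (U q) \<alpha> = Poly_Mapping.lookup 0 \<alpha>" by simp
    qed
    ultimately show ?thesis by auto
  qed
  from ex_has_least_nat[of "\<lambda>q. q \<noteq> 0 \<and> U q \<in> N" _ degree] this
  obtain q where q: "q \<noteq> 0" "U q \<in> N"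
    and min: "\<And>q'. q' \<noteq> 0 \<Longrightarrow> U q' \<in> N \<Longrightarrow> degree q \<le> degree q'" by blast
  have "degree q \<noteq> 0"
  proof
    assume "degree q = 0"
    then obtain c where qc: "q = [:c:]" by (auto elim: degree_eq_zeroE)
    with q have "c \<noteq> 0" by auto
    have "cst (1 / c) * U q = v"
      using \<open>c \<noteq> 0\<close> by (simp add: U_def qc u0 mult.assoc[symmetric] mult_single)
    with v null_space_cst_mult[OF q(2), of "1 / c"] show False by simp
  qed
  from real_poly_factor[OF this] show ?thesis
  proof (elim disjE exE conjE)
    fix c q' assume qq': "q = [:-c, 1:] * q'"
    then have "q' \<noteq> 0" using q by auto
    then have "degree q' < degree q" unfolding qq' by (subst degree_mult_eq) auto
    then have "U q' \<notin> N" using min[OF \<open>q' \<noteq> 0\<close>] by linarith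
    moreover have "Xvar j * U q' - cst c * U q' \<in> N"
      using null_space_add[OF U_linear[where q = q' and c = c] q(2)]
      by (simp add: qq' algebra_simps)
    ultimately show ?thesis using UE by blast
  next
    fix a b q' assume b: "b \<noteq> 0" and qq': "q = [:a\<^sup>2 + b\<^sup>2, -2 * a, 1:] * q'"
    then have "q' \<noteq> 0" using q by auto
    then have "degree q' < degree q" unfolding qq' by (subst degree_mult_eq) auto
    then have notN: "U q' \<notin> N" using min[OF \<open>q' \<noteq> 0\<close>] by linarith
    let ?w = "U q'" and ?x = "U ([:-a, 1:] * q')"
    have le: "U p \<in> polys_le (Suc e)" for p using UE[of p] E polys_le_SucI by blast
    have "q = [:-a, 1:] * ([:-a, 1:] * q') + Polynomial.smult (b\<^sup>2) q'"
    proof -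
      have "[:a\<^sup>2 + b\<^sup>2, -2 * a, 1:] = [:-a, 1:] * [:-a, 1:] + [:b\<^sup>2:]"
        by (simp add: power2_eq_square)
      then have "q = [:-a, 1:] * ([:-a, 1:] * q') + [:b\<^sup>2:] * q'"
        unfolding qq' by (simp only: distrib_right mult.assoc)
      then show ?thesis by simp
    qed
    then have Uq: "U q = U ([:-a, 1:] * ([:-a, 1:] * q')) + cst (b\<^sup>2) * ?w"
      by (simp only: U_add U_smult)
    have "L ((cst a * ?x + U ([:-a, 1:] * ([:-a, 1:] * q'))) * ?w) = L (?x * (cst a * ?w + ?x))"
      by (rule multiplication_symmetric)
        (use UE E le in \<open>auto intro!: U_linear polys_le_add polys_le_cst_mult simp del: mult_pCons_left\<close>)
    then have "L (U ([:-a, 1:] * ([:-a, 1:] * q')) * ?w) = L (?x * ?x)"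
      by (simp add: distrib_right distrib_left riesz_add mult_ac del: mult_pCons_left)
    moreover have "L (U q * ?w) = 0" by (rule null_space_mult[OF q(2) le])
    ultimately have "L (?x * ?x) + b\<^sup>2 * L (?w * ?w) = 0"
      by (simp add: Uq distrib_right riesz_add mult.assoc riesz_cst_mult del: mult_pCons_left)
    moreover have "0 \<le> L (?x * ?x)" using positive le by (auto simp: positive_on_def)
    moreover have "0 < b\<^sup>2 * L (?w * ?w)" using b null_space_pos[OF positive le notN] by simp
    ultimately show ?thesis by linarith
  qed
qed

text \<open>
  The variables are treated one after another. The vectors that are eigenvectors for the variables in \<open>I\<close>,
  with the eigenvalues found so far, form a subspace that is stable under every further \<open>X\<^sub>j\<close> because
  the operators commute modulo \<open>N\<close>; inside it the lemma above finds an eigenvector for \<open>X\<^sub>j\<close>.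
\<close>

lemma common_eigenvector:
  assumes v: "v \<in> polys_le e" "v \<notin> N"
  obtains a :: "real ^ 'n" and w where "w \<in> polys_le e" "w \<notin> N"
    "\<And>i. Xvar i * w - cst (vec_nth a i) * w \<in> N"
proof -
  have "\<exists>a :: 'n \<Rightarrow> real. \<exists>w\<in>polys_le e. w \<notin> N \<and> (\<forall>i\<in>I. Xvar i * w - cst (a i) * w \<in> N)" for I
  proof (induction I rule: infinite_finite_induct)
    case (insert j I)
    then obtain a :: "'n \<Rightarrow> real" and w where w: "w \<in> polys_le e" "w \<notin> N"
      "\<And>i. i \<in> I \<Longrightarrow> Xvar i * w - cst (a i) * w \<in> N" by blast
    define E where "E = {p \<in> polys_le e. \<forall>i\<in>I. Xvar i * p - cst (a i) * p \<in> N}"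
    have "\<exists>c. \<exists>w\<in>E. w \<notin> N \<and> Xvar j * w - cst c * w \<in> N"
    proof (rule eigenvector_in_stable_subspace)
      show "E \<subseteq> polys_le e" by (auto simp: E_def)
      show "w \<in> E" "w \<notin> N" using w by (auto simp: E_def)
      show "p + q \<in> E" if "p \<in> E" "q \<in> E" for p q
      proof -
        have "Xvar i * (p + q) - cst (a i) * (p + q) =
          (Xvar i * p - cst (a i) * p) + (Xvar i * q - cst (a i) * q)" for i
          by (simp add: algebra_simps)
        with that show ?thesis by (auto simp: E_def intro: polys_le_add null_space_add)
      qed
      show "cst c * p \<in> E" if "p \<in> E" for c p
      proof -
        have "Xvar i * (cst c * p) - cst (a i) * (cst c * p)
          = cst c * (Xvar i * p - cst (a i) * p)" for i
          by (simp add: algebra_simps)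
        with that show ?thesis by (auto simp: E_def intro: polys_le_cst_mult null_space_cst_mult)
      qed
      fix p assume "p \<in> E"
      then have p: "p \<in> polys_le e" and pN: "\<And>i. i \<in> I \<Longrightarrow> Xvar i * p - cst (a i) * p \<in> N"
        by (auto simp: E_def)
      obtain p' where p': "p' \<in> polys_le e" "Xvar j * p - p' \<in> N"
        using flat[OF polys_le_Xvar_mult[OF p]] by blast
      \<comment> \<open>Moving \<open>X\<^sub>i - a i\<close> to the test polynomial leaves degree \<open>e + 1\<close>, where \<open>p'\<close> may be replaced by \<open>X\<^sub>j p\<close>.\<close>
      have "Xvar i * p' - cst (a i) * p' \<in> N" if "i \<in> I" for i
      proof (rule null_space_test)
        show "Xvar i * p' - cst (a i) * p' \<in> polys_le (Suc e)"
          using p' by (intro polys_le_diff polys_le_Xvar_mult polys_le_cst_mult)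
            (auto intro: polys_le_SucI)
        fix g :: "'n rpoly" assume g: "g \<in> polys_le e"
        let ?h = "Xvar i * g - cst (a i) * g"
        have h: "?h \<in> polys_le (Suc e)"
          using g by (intro polys_le_diff polys_le_Xvar_mult polys_le_cst_mult)
            (auto intro: polys_le_SucI)
        have "L ((Xvar j * p - p') * ?h) = 0" by (rule null_space_mult[OF p'(2) h])
        moreover have "L ((Xvar i * p - cst (a i) * p) * (Xvar j * g)) = 0"
          by (rule null_space_mult[OF pN[OF that] polys_le_Xvar_mult[OF g]])
        moreover have "(Xvar i * p' - cst (a i) * p') * g =
            (Xvar i * p - cst (a i) * p) * (Xvar j * g) - (Xvar j * p - p') * ?h"
          by (simp add: algebra_simps)
        ultimately show "L ((Xvar i * p' - cst (a i) * p') * g) = 0" by (simp add: riesz_diff)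
      qed
      with p' show "\<exists>p'\<in>E. Xvar j * p - p' \<in> N" by (auto simp: E_def)
    qed
    then obtain c w' where "w' \<in> E" "w' \<notin> N" "Xvar j * w' - cst c * w' \<in> N" by blast
    then show ?case
      using insert.hyps by (intro exI[of _ "a(j := c)"] bexI[of _ w']) (auto simp: E_def)
  qed (use v in auto)
  from this[of UNIV] obtain a :: "'n \<Rightarrow> real" and w where "w \<in> polys_le e" "w \<notin> N"
    "\<forall>i. Xvar i * w - cst (a i) * w \<in> N" by auto
  then show thesis by (intro that[of w "\<chi> i. a i"]) auto
qed

text \<open>
  Replace the factors \<open>X\<^sub>i\<close> of a monomial by the eigenvalues \<open>a\<^sub>i\<close> one at a time. What remains of the
  monomial has degree at most \<open>e\<close>, so it is an admissible test polynomial for \<open>X\<^sub>i w - a\<^sub>i w \<in> N\<close>.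
\<close>

lemma eigenvector_evaluation:
  assumes w: "w \<in> polys_le e" and a: "\<And>i. Xvar i * w - cst (vec_nth a i) * w \<in> N"
    and q: "q \<in> polys_le (Suc e)"
  shows "L (q * w) = rpoly_eval q a * L w"
proof -
  have mono: "L (xpow \<alpha> * w) = mono_eval \<alpha> a * L w" if "mono_deg \<alpha> \<le> Suc e" for \<alpha>
    using that
  proof (induction "mono_deg \<alpha>" arbitrary: \<alpha>)
    case 0
    then have "Poly_Mapping.lookup \<alpha> i = 0" for i by (simp add: mono_deg_def)
    then have "\<alpha> = 0" by (intro poly_mapping_eqI) simp
    then show ?case by simp
  next
    case (Suc k)
    then have "mono_deg \<alpha> \<noteq> 0" by simp
    then obtain i \<beta> where \<alpha>: "\<alpha> = Poly_Mapping.single i 1 + \<beta>" by (rule mono_split_var)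
    have deg: "mono_deg \<beta> = k" "mono_deg \<beta> \<le> e" using Suc by (auto simp: \<alpha>)
    have "xpow \<alpha> * w = xpow \<beta> * (Xvar i * w)"
      by (simp add: \<alpha> Xvar_def mult_single mult.assoc[symmetric] add.commute)
    moreover have "L ((Xvar i * w - cst (vec_nth a i) * w) * xpow \<beta>) = 0"
      by (rule null_space_mult[OF a]) (use deg in \<open>auto intro: polys_le_xpow\<close>)
    then have "L (xpow \<beta> * (Xvar i * w)) = L (cst (vec_nth a i) * (xpow \<beta> * w))"
      by (simp add: algebra_simps riesz_diff)
    ultimately have "L (xpow \<alpha> * w) = vec_nth a i * L (xpow \<beta> * w)"
      by (simp add: riesz_cst_mult)
    also have "\<dots> = mono_eval \<alpha> a * L w"
      using Suc.hyps(1)[of \<beta>] deg by (simp add: \<alpha> mono_eval_add mono_eval_single del: One_nat_def)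
    finally show ?case .
  qed
  have "L (q * w) = (\<Sum>\<alpha>\<in>Poly_Mapping.keys q. Poly_Mapping.lookup q \<alpha> * L (xpow \<alpha> * w))"
    using riesz_mult_expand_right[of z w q] by (simp add: mult.commute)
  also have "\<dots> = (\<Sum>\<alpha>\<in>Poly_Mapping.keys q. Poly_Mapping.lookup q \<alpha> * (mono_eval \<alpha> a * L w))"
    using q mono by (intro sum.cong) (auto simp: polys_le_def)
  finally show ?thesis by (simp add: rpoly_eval_def sum_distrib_right mult.assoc)
qed

text \<open>
  With \<open>l = L(w)\<^sup>2 / L(w\<^sup>2)\<close>, the identity \<open>q(a) L(w) = L(q w)\<close> turns positivity of the new functional into
  the Cauchy-Schwarz inequality for \<open>q\<close> and \<open>w\<close>, with equality at \<open>q = w\<close>. The same identity shows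
  that every element of the old radical vanishes at \<open>a\<close>; so the old radical is contained in the new one, and
  flatness is inherited.
\<close>

lemma deflation:
  assumes v: "v \<in> polys_le e" "v \<notin> N"
  obtains a :: "real ^ 'n" and w l where "w \<in> polys_le e" "rpoly_eval w a \<noteq> 0" "0 < l"
    "flat_functional e (\<lambda>\<alpha>. z \<alpha> - l * mono_eval \<alpha> a)"
    "w \<in> null_space (Suc e) (\<lambda>\<alpha>. z \<alpha> - l * mono_eval \<alpha> a)"
proof -
  obtain a :: "real ^ 'n" and w where w: "w \<in> polys_le e" "w \<notin> N"
    and a: "\<And>i. Xvar i * w - cst (vec_nth a i) * w \<in> N"
    using common_eigenvector[OF v] by blast
  have wd: "w \<in> polys_le (Suc e)" using w polys_le_SucI by blast
  have ev: "L (q * w) = rpoly_eval q a * L w" if "q \<in> polys_le (Suc e)" for q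
    by (rule eigenvector_evaluation[OF w(1) a that])
  have ww: "0 < L (w * w)" by (rule null_space_pos[OF positive wd w(2)])
  then have c: "L w \<noteq> 0" "rpoly_eval w a \<noteq> 0" using ev[OF wd] by auto
  define l where "l = (L w)\<^sup>2 / L (w * w)"
  define z' where "z' = (\<lambda>\<alpha>. z \<alpha> - l * mono_eval \<alpha> a)"
  have riesz_z': "riesz z' p = L p - l * rpoly_eval p a" for p
    by (simp add: riesz_def z'_def rpoly_eval_def algebra_simps sum_subtractf sum_distrib_left)
  have l: "0 < l" using ww c by (simp add: l_def)
  have pos: "positive_on (Suc e) z'"
    unfolding positive_on_def
  proof
    fix q :: "'n rpoly" assume q: "q \<in> polys_le (Suc e)"
    have "(L (q * w))\<^sup>2 \<le> L (q * q) * L (w * w)"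
      by (rule cauchy_schwarz[OF positive q wd])
    then have "(rpoly_eval q a)\<^sup>2 * (L w)\<^sup>2 / L (w * w) \<le> L (q * q)"
      using ww by (simp add: ev[OF q] power_mult_distrib pos_divide_le_eq)
    then show "0 \<le> riesz z' (q * q)"
      by (simp add: riesz_z' l_def rpoly_eval_mult power2_eq_square algebra_simps)
  qed
  have sub: "N \<subseteq> null_space (Suc e) z'"
  proof
    fix p assume p: "p \<in> N"
    then have "rpoly_eval p a * L w = 0"
      using ev[of p] null_space_mult[OF p wd] null_space_polys_le[OF p] by simp
    then have "rpoly_eval p a = 0" using c by simp
    with p show "p \<in> null_space (Suc e) z'"
      by (simp add: null_space_def riesz_z' rpoly_eval_mult)
  qed
  have "flat_functional e z'"
    by unfold_locales (use pos flat sub in blast)+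
  moreover have "w \<in> null_space (Suc e) z'"
  proof (rule null_spaceI[OF pos wd])
    have "L (w * w) = rpoly_eval w a * L w" by (rule ev[OF wd])
    then have "l * rpoly_eval (w * w) a = L (w * w)"
      using c by (simp add: l_def rpoly_eval_mult field_simps power2_eq_square)
    then show "riesz z' (w * w) = 0" by (simp add: riesz_z')
  qed
  ultimately show thesis using that[of w a l] w c l unfolding z'_def by blast
qed

end

section \<open>The rank of a symmetric matrix after a rank one change\<close>

(* From here on the dollar sign denotes entries of vectors with a carrier. *)
unbundle no vec_syntax

text \<open>
  A basis of the smaller column space stays independent when \<open>u\<close> is added.
\<close>

lemma (in vec_space) rank_less_col_space:
  assumes A: "A \<in> carrier_mat n nc" and B: "B \<in> carrier_mat n nc'"
    and sub: "col_space A \<subseteq> col_space B" and u: "u \<in> col_space B" "u \<notin> col_space A"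
  shows "rank A < rank B"
proof -
  have cA: "set (cols A) \<subseteq> carrier_vec n" and cB: "set (cols B) \<subseteq> carrier_vec n"
    using A B cols_dim by blast+
  obtain S where S: "maximal S (\<lambda>T. T \<subseteq> set (cols A) \<and> lin_indpt T)"
    using maximal_exists_superset[of "set (cols A)" "\<lambda>T. T \<subseteq> set (cols A) \<and> lin_indpt T" "{}"]
    by (auto simp: lin_dep_def)
  then have SA: "S \<subseteq> set (cols A)" and ind: "lin_indpt S" by (auto simp: maximal_def)
  have fin: "finite S" using SA finite_subset by blast
  have "span S \<subseteq> col_space A" unfolding col_space_def using SA by (rule span_is_monotone)
  with u have uS: "u \<notin> span S" by blast
  have Sc: "S \<subseteq> carrier_vec n" using SA cA by blast
  have uc: "u \<in> carrier_vec n" using u(1) cB unfolding col_space_def by (rule span_closed[rotated])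
  have "u \<notin> S" using uS span_mem[OF Sc] by blast
  have ind': "lin_indpt (S \<union> {u})"
    using lin_dep_iff_in_span[OF Sc ind uc \<open>u \<notin> S\<close>] uS by blast
  have sub': "S \<union> {u} \<subseteq> span (set (cols B))"
    using SA in_own_span[OF cA] sub u(1) unfolding col_space_def by blast
  have subm: "submodule class_ring (span (set (cols B))) V"
    by (rule span_is_submodule[OF cB])
  have vs: "vectorspace class_ring (span_vs (set (cols B)))"
    using span_is_subspace[OF cB] by (rule subspace_is_vs)
  have "card (S \<union> {u}) \<le> vectorspace.dim class_ring (span_vs (set (cols B)))"
  proof (rule vectorspace.li_le_dim(2)[OF vs fin_dim_span_cols[OF B]])
    show "S \<union> {u} \<subseteq> carrier (span_vs (set (cols B)))" using sub' by simp
    show "\<not> LinearCombinations.module.lin_dep class_ring (span_vs (set (cols B))) (S \<union> {u})"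
      using span_li_not_depend(2)[OF sub' subm] ind' by simp
  qed
  then have "Suc (card S) \<le> rank B" using \<open>u \<notin> S\<close> fin by (simp add: rank_def)
  with rank_card_indpt[OF A S] show ?thesis by simp
qed

text \<open>
  Subadditivity bounds the rank from above. For the lower bound, \<open>u\<close> is not in the range of \<open>A\<close>, since this
  range is orthogonal to the kernel vector \<open>v\<close>; the new matrix maps \<open>v\<close> to a nonzero multiple of \<open>u\<close>, and
  its range also contains the range of \<open>A\<close>, because a multiple of \<open>v\<close> can be subtracted from
  the argument to make it orthogonal to \<open>u\<close> without changing its image under \<open>A\<close>.
\<close>

lemma (in vec_space) rank_symmetric_add_rank_one:
  assumes A: "A \<in> carrier_mat n n" "transpose_mat A = A"
    and u: "u \<in> carrier_vec n" and v: "v \<in> carrier_vec n"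
    and Av: "A *\<^sub>v v = 0\<^sub>v n" and uv: "u \<bullet> v \<noteq> 0" and c: "c \<noteq> 0"
  shows "rank (A + mat n n (\<lambda>(i, j). c * u $ i * u $ j)) = Suc (rank A)"
proof -
  let ?R = "mat n n (\<lambda>(i, j). c * u $ i * u $ j)"
  let ?B = "A + ?R"
  have B: "?B \<in> carrier_mat n n" using A by simp
  have Rx: "?R *\<^sub>v x = (c * (u \<bullet> x)) \<cdot>\<^sub>v u" if x: "x \<in> carrier_vec n" for x
    using u x by (intro eq_vecI)
      (auto simp: scalar_prod_def sum_distrib_left sum_distrib_right mult_ac intro!: sum.cong)
  have Bx: "?B *\<^sub>v x = A *\<^sub>v x + (c * (u \<bullet> x)) \<cdot>\<^sub>v u" if x: "x \<in> carrier_vec n" for x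
    using add_mult_distrib_mat_vec[of A n n ?R x] A x Rx[OF x] by simp
  have cs: "y \<in> col_space C \<longleftrightarrow> y \<in> carrier_vec n \<and> (\<exists>x\<in>carrier_vec n. C *\<^sub>v x = y)"
    if "C \<in> carrier_mat n n" for C y
    using col_space_eq[OF that] that by auto
  have "rank ?B \<le> rank A + rank ?R" by (rule rank_subadditive) (use A in auto)
  moreover have "rank ?R \<le> 1"
    by (rule rank_le_1_product_entries[where nc = n and f = "\<lambda>i. c * u $ i" and g = "\<lambda>j. u $ j"]) auto
  moreover have "rank A < rank ?B"
  proof (rule rank_less_col_space[OF A(1) B])
    show "u \<in> col_space ?B"
    proof -
      have "?B *\<^sub>v ((1 / (c * (u \<bullet> v))) \<cdot>\<^sub>v v) = (1 / (c * (u \<bullet> v))) \<cdot>\<^sub>v (?B *\<^sub>v v)"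
        by (rule mult_mat_vec[OF B v])
      also have "\<dots> = u" using u v c uv by (simp add: Bx Av smult_smult_assoc)
      finally show ?thesis using cs[OF B] u v by (metis smult_carrier_vec)
    qed
    show "u \<notin> col_space A"
    proof
      assume "u \<in> col_space A"
      then obtain x where x: "x \<in> carrier_vec n" "A *\<^sub>v x = u" using cs[OF A(1)] by blast
      have "u \<bullet> v = v \<bullet> (A *\<^sub>v x)" using x u v by (metis comm_scalar_prod)
      also have "\<dots> = (A *\<^sub>v v) \<bullet> x" using transpose_vec_mult_scalar[OF A(1) x(1) v] A(2) by simp
      finally show False using uv Av x by simp
    qed
    show "col_space A \<subseteq> col_space ?B"
    proof
      fix y assume "y \<in> col_space A"
      then obtain x where x: "x \<in> carrier_vec n" "A *\<^sub>v x = y" and y: "y \<in> carrier_vec n"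
        using cs[OF A(1)] by blast
      let ?t = "(u \<bullet> x) / (u \<bullet> v)"
      have "u \<bullet> (x - ?t \<cdot>\<^sub>v v) = 0"
        using u v x uv by (simp add: scalar_prod_minus_distrib)
      moreover have "A *\<^sub>v (x - ?t \<cdot>\<^sub>v v) = y"
        using A v x y by (simp add: mult_minus_distrib_mat_vec mult_mat_vec[OF A(1)] Av)
      ultimately have "?B *\<^sub>v (x - ?t \<cdot>\<^sub>v v) = y" using x v y u by (simp add: Bx)
      then show "y \<in> col_space ?B" using cs[OF B] y x v by (metis minus_carrier_vec smult_carrier_vec)
    qed
  qed
  ultimately show ?thesis by linarith
qed

section \<open>Moment matrices as Gram matrices\<close>

lemma sum_mono_list:
  fixes g :: "'n::finite mono \<Rightarrow> 'a::comm_monoid_add"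
  shows "(\<Sum>i = 0..<num_monos TYPE('n) k. g (mono_list k ! i)) = (\<Sum>\<alpha> | mono_deg \<alpha> \<le> k. g \<alpha>)"
proof -
  have "bij_betw (\<lambda>i. (mono_list k :: 'n mono list) ! i) {..<length (mono_list k :: 'n mono list)} {\<alpha>. mono_deg \<alpha> \<le> k}"
    by (rule bij_betw_nth) (auto simp: mono_list)
  then have "(\<Sum>i<length (mono_list k :: 'n mono list). g (mono_list k ! i)) = (\<Sum>\<alpha> | mono_deg \<alpha> \<le> k. g \<alpha>)"
    by (rule sum.reindex_bij_betw)
  then show ?thesis by (simp add: num_monos_def atLeast0LessThan)
qed

lemma mono_list_nth_deg:
  "i < num_monos TYPE('n::finite) k \<Longrightarrow> mono_deg (mono_list k ! i :: 'n mono) \<le> k"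
  using nth_mem[of i "mono_list k :: 'n mono list"] by (simp add: num_monos_def mono_list)

lemma mono_list_index:
  assumes "mono_deg (\<alpha> :: 'n::finite mono) \<le> k"
  obtains i where "i < num_monos TYPE('n) k" "mono_list k ! i = \<alpha>"
  using assms mono_list(1)[of k, where 'n = 'n]
  by (metis (mono_tags, lifting) in_set_conv_nth mem_Collect_eq num_monos_def)

lemma keys_polys_le: "p \<in> polys_le k \<longleftrightarrow> Poly_Mapping.keys p \<subseteq> {\<alpha>. mono_deg \<alpha> \<le> k}"
  by (auto simp: polys_le_def)

lemma riesz_mult_xpow:
  assumes "p \<in> polys_le k"
  shows "riesz z (xpow \<beta> * p) = (\<Sum>\<alpha> | mono_deg \<alpha> \<le> k. z (\<beta> + \<alpha>) * Poly_Mapping.lookup p \<alpha>)"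
  using riesz_mult_expand[of "{\<beta>}" "xpow \<beta>" "{\<alpha>. mono_deg \<alpha> \<le> k}" p z] assms
  by (simp add: finite_mono_deg_le keys_polys_le mult.commute)

definition coeff_vec :: "nat \<Rightarrow> 'n::finite rpoly \<Rightarrow> real vec" where
  "coeff_vec k p = vec (num_monos TYPE('n) k) (\<lambda>i. Poly_Mapping.lookup p (mono_list k ! i))"

lemma coeff_vec_carrier [simp]:
  "coeff_vec k (p :: 'n::finite rpoly) \<in> carrier_vec (num_monos TYPE('n) k)"
  by (simp add: coeff_vec_def)

lemma moment_matrix_carrier [simp]:
  "moment_matrix k (z :: 'n::finite mono \<Rightarrow> real) \<in> carrier_mat (num_monos TYPE('n) k) (num_monos TYPE('n) k)"
  by (simp add: moment_matrix_def)

lemma moment_matrix_mult_coeff_vec: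
  fixes z :: "'n::finite mono \<Rightarrow> real"
  assumes "p \<in> polys_le k"
  shows "moment_matrix k z *\<^sub>v coeff_vec k p =
    vec (num_monos TYPE('n) k) (\<lambda>i. riesz z (xpow (mono_list k ! i) * p))"
proof (rule eq_vecI)
  fix i assume "i < dim_vec (vec (num_monos TYPE('n) k) (\<lambda>i. riesz z (xpow (mono_list k ! i) * p)))"
  then show "(moment_matrix k z *\<^sub>v coeff_vec k p) $ i =
      vec (num_monos TYPE('n) k) (\<lambda>i. riesz z (xpow (mono_list k ! i) * p)) $ i"
    using sum_mono_list[of "\<lambda>\<alpha>. z (mono_list k ! i + \<alpha>) * Poly_Mapping.lookup p \<alpha>" k]
    by (simp add: moment_matrix_def coeff_vec_def scalar_prod_def riesz_mult_xpow[OF assms])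
qed (simp add: moment_matrix_def)

lemma scalar_prod_coeff_vec:
  fixes p :: "'n::finite rpoly"
  assumes "p \<in> polys_le k"
  shows "vec (num_monos TYPE('n) k) (\<lambda>i. g (mono_list k ! i)) \<bullet> coeff_vec k p = riesz g p"
  using sum_mono_list[of "\<lambda>\<alpha>. g \<alpha> * Poly_Mapping.lookup p \<alpha>" k]
    riesz_superset[of "{\<alpha>. mono_deg \<alpha> \<le> k}" p g] assms
  by (simp add: coeff_vec_def scalar_prod_def finite_mono_deg_le keys_polys_le mult.commute)

lemma psd_moment_matrix_imp_positive_on:
  fixes z :: "'n::finite mono \<Rightarrow> real"
  assumes "psd (moment_matrix k z)"
  shows "positive_on k z"
  unfolding positive_on_def
proof
  fix p :: "'n rpoly" assume p: "p \<in> polys_le k"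
  let ?v = "coeff_vec k p"
  have "0 \<le> ?v \<bullet> (moment_matrix k z *\<^sub>v ?v)"
    using assms by (simp add: psd_def moment_matrix_def coeff_vec_def)
  also have "\<dots> = (moment_matrix k z *\<^sub>v ?v) \<bullet> ?v"
    by (rule comm_scalar_prod[OF coeff_vec_carrier
      mult_mat_vec_carrier[OF moment_matrix_carrier coeff_vec_carrier]])
  also have "\<dots> = riesz (\<lambda>\<alpha>. riesz z (xpow \<alpha> * p)) p"
    unfolding moment_matrix_mult_coeff_vec[OF p] by (rule scalar_prod_coeff_vec[OF p])
  also have "\<dots> = riesz z (p * p)"
    using riesz_mult_expand_right[of z p p]
    by (simp add: riesz_def[of "\<lambda>\<alpha>. riesz z (xpow \<alpha> * p)"] mult.commute[of p "xpow _"])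
  finally show "0 \<le> riesz z (p * p)" .
qed

text \<open>
  Subtracting a point evaluation from the functional subtracts the rank one matrix \<open>l V(a) V(a)\<^sup>T\<close> from the
  moment matrix. The new null vector \<open>w\<close> is not orthogonal to \<open>V(a)\<close> because \<open>w(a) \<noteq> 0\<close>.
\<close>

lemma rank_moment_matrix_deflation:
  fixes z :: "'n::finite mono \<Rightarrow> real" and e :: nat
  defines "n \<equiv> num_monos TYPE('n) e"
  assumes w: "w \<in> polys_le e" "w \<in> null_space (Suc e) (\<lambda>\<alpha>. z \<alpha> - l * mono_eval \<alpha> a)"
    and "rpoly_eval w a \<noteq> 0" "l \<noteq> 0"
  shows "vec_space.rank n (moment_matrix e z) =
    Suc (vec_space.rank n (moment_matrix e (\<lambda>\<alpha>. z \<alpha> - l * mono_eval \<alpha> a)))"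
proof -
  let ?z = "\<lambda>\<alpha>. z \<alpha> - l * mono_eval \<alpha> a"
  let ?A = "moment_matrix e ?z" and ?u = "vec n (\<lambda>i. mono_eval (mono_list e ! i) a)"
  have "vec_space.rank n (?A + mat n n (\<lambda>(i, j). l * ?u $ i * ?u $ j)) = Suc (vec_space.rank n ?A)"
  proof (rule vec_space.rank_symmetric_add_rank_one)
    show "?A \<in> carrier_mat n n" by (simp add: n_def)
    show "transpose_mat ?A = ?A"
      by (rule eq_matI) (auto simp: moment_matrix_def add.commute)
    show "coeff_vec e w \<in> carrier_vec n" by (simp add: n_def)
    have "riesz ?z (xpow (mono_list e ! i) * w) = 0" if "i < n" for i
      using null_space_mult[OF w(2) polys_le_SucI[OF polys_le_xpow]] mono_list_nth_deg that
      by (metis mult.commute n_def)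
    then show "?A *\<^sub>v coeff_vec e w = 0\<^sub>v n"
      by (subst moment_matrix_mult_coeff_vec[OF w(1)]) (auto simp: n_def)
    show "?u \<bullet> coeff_vec e w \<noteq> 0"
      using assms scalar_prod_coeff_vec[OF w(1), of "\<lambda>\<alpha>. mono_eval \<alpha> a"]
      by (simp add: rpoly_eval_eq_riesz)
  qed (use assms in auto)
  moreover have "?A + mat n n (\<lambda>(i, j). l * ?u $ i * ?u $ j) = moment_matrix e z"
    by (rule eq_matI) (auto simp: moment_matrix_def n_def mono_eval_add)
  ultimately show ?thesis by simp
qed

section \<open>Atomic decomposition of flat functionals\<close>

text \<open>
  Induction on the rank. If some polynomial of degree \<open>e\<close> lies outside the radical, deflation removes one atom
  and lowers the rank by one. If there is none, then the moment matrix of order \<open>e\<close> vanishes, and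
  flatness makes the functional vanish up to degree \<open>2 (e + 1)\<close>.
\<close>

theorem flat_functional_atomic:
  fixes z :: "'n::finite mono \<Rightarrow> real"
  assumes "flat_functional e z"
    and "r = vec_space.rank (num_monos TYPE('n) e) (moment_matrix e z)"
  shows "\<exists>(a :: nat \<Rightarrow> real ^ 'n) l. (\<forall>i\<in>{1..r}. l i > 0) \<and>
    (\<forall>\<alpha>. mono_deg \<alpha> \<le> 2 * Suc e \<longrightarrow> z \<alpha> = (\<Sum>i = 1..r. l i * mono_eval \<alpha> (a i)))"
  using assms
proof (induction r arbitrary: z)
  case 0
  interpret flat_functional e z by fact
  have e: "p \<in> N" if p: "p \<in> polys_le e" for p
  proof (rule ccontr)
    assume "p \<notin> N"
    then obtain a :: "real ^ 'n" and w l where *: "w \<in> polys_le e" "rpoly_eval w a \<noteq> 0" "0 < l"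
      "w \<in> null_space (Suc e) (\<lambda>\<alpha>. z \<alpha> - l * mono_eval \<alpha> a)"
      using deflation[OF p] by blast
    have "l \<noteq> 0" using * by simp
    from rank_moment_matrix_deflation[OF *(1,4,2) this] 0(2) show False by simp
  qed
  have "z \<alpha> = 0" if \<alpha>: "mono_deg \<alpha> \<le> 2 * Suc e" for \<alpha>
  proof -
    have "mono_deg \<alpha> \<le> Suc e + Suc e" using \<alpha> by simp
    then obtain \<beta> \<gamma> where bc: "\<alpha> = \<beta> + \<gamma>" "mono_deg \<beta> \<le> Suc e" "mono_deg \<gamma> \<le> Suc e"
      using mono_split_deg by blast
    have b: "xpow \<beta> \<in> polys_le (Suc e)" and c: "xpow \<gamma> \<in> polys_le (Suc e)"
      using bc by (auto intro: polys_le_xpow)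
    obtain p' where p': "p' \<in> polys_le e" "xpow \<beta> - p' \<in> N" using flat[OF b] by blast
    then have "xpow \<beta> \<in> N" using null_space_add[OF p'(2) e[OF p'(1)]] by simp
    then have "riesz z (xpow \<beta> * xpow \<gamma>) = 0" using c by (rule null_space_mult)
    then show ?thesis by (simp add: bc mult_single)
  qed
  then show ?case by simp
next
  case (Suc r)
  interpret flat_functional e z by fact
  let ?n = "num_monos TYPE('n) e"
  have "\<exists>v\<in>polys_le e. v \<notin> N"
  proof (rule ccontr)
    assume "\<not> ?thesis"
    then have all: "xpow \<alpha> \<in> N" if "mono_deg \<alpha> \<le> e" for \<alpha> using that polys_le_xpow by blast
    have "z (\<alpha> + \<beta>) = 0" if "mono_deg \<alpha> \<le> e" "mono_deg \<beta> \<le> e" for \<alpha> \<beta>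
      using null_space_mult[OF all[OF that(1)] polys_le_SucI[OF polys_le_xpow[OF that(2)]]]
      by (simp add: mult_single)
    then have "moment_matrix e z = 0\<^sub>m ?n ?n"
      by (intro eq_matI) (auto simp: moment_matrix_def mono_list_nth_deg)
    then show False using Suc.prems(2) vec_space.rank_0I[where n = ?n and nc = ?n and 'a = real] by simp
  qed
  then obtain a0 :: "real ^ 'n" and w l0 where *: "w \<in> polys_le e" "rpoly_eval w a0 \<noteq> 0" "0 < l0"
    "w \<in> null_space (Suc e) (\<lambda>\<alpha>. z \<alpha> - l0 * mono_eval \<alpha> a0)"
    and flat': "flat_functional e (\<lambda>\<alpha>. z \<alpha> - l0 * mono_eval \<alpha> a0)"
    using deflation by blast
  have "l0 \<noteq> 0" using * by simp
  from rank_moment_matrix_deflation[OF *(1,4,2) this] Suc.prems(2)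
  have "r = vec_space.rank ?n (moment_matrix e (\<lambda>\<alpha>. z \<alpha> - l0 * mono_eval \<alpha> a0))" by simp
  from Suc.IH[OF flat' this] obtain a :: "nat \<Rightarrow> real ^ 'n" and l where
    al: "\<forall>i\<in>{1..r}. l i > 0" "\<And>\<alpha>. mono_deg \<alpha> \<le> 2 * Suc e \<Longrightarrow>
       z \<alpha> - l0 * mono_eval \<alpha> a0 = (\<Sum>i = 1..r. l i * mono_eval \<alpha> (a i))" by blast
  have "(\<Sum>i = 1..Suc r. (l(Suc r := l0)) i * mono_eval \<alpha> ((a(Suc r := a0)) i)) =
     (\<Sum>i = 1..r. l i * mono_eval \<alpha> (a i)) + l0 * mono_eval \<alpha> a0" for \<alpha>
    by simp
  with al *(3) show ?case
    by (intro exI[of _ "a(Suc r := a0)"] exI[of _ "l(Suc r := l0)"]) (auto simp: algebra_simps le_Suc_eq)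
qed

section \<open>The modified moment matrix\<close>

lemma riesz_test_monomials:
  assumes "\<And>\<alpha>. \<alpha> \<in> Poly_Mapping.keys g \<Longrightarrow> riesz z (p * xpow \<alpha>) = 0"
  shows "riesz z (p * g) = 0"
  using assms by (subst riesz_mult_expand_right) simp

text \<open>
  Gram-Schmidt for a form that may be degenerate. The new monomial \<open>X\<^sup>\<alpha>\<close> is replaced by its component \<open>\<epsilon>\<close>
  orthogonal to the previous ones. If \<open>L(\<epsilon>\<^sup>2) = 0\<close>, then \<open>\<epsilon>\<close> is in the radical and needs no correction; the
  convention \<open>x / 0 = 0\<close> makes the formula for \<open>t\<close> valid in this case as well.
\<close>

lemma orthogonal_projection:
  assumes pos: "positive_on d z" and "finite S" "S \<subseteq> {\<alpha>. mono_deg \<alpha> \<le> d}" and q: "q \<in> polys_le d"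
  shows "\<exists>w. Poly_Mapping.keys w \<subseteq> S \<and> (\<forall>\<alpha>\<in>S. riesz z ((q - w) * xpow \<alpha>) = 0)"
  using assms(2-)
proof (induction S arbitrary: q rule: finite_induct)
  case empty
  then show ?case by (intro exI[of _ 0]) simp
next
  case (insert \<alpha> S)
  have S: "S \<subseteq> {\<alpha>. mono_deg \<alpha> \<le> d}" using insert.prems by simp
  have \<alpha>: "xpow \<alpha> \<in> polys_le d" using insert.prems by (auto intro: polys_le_xpow)
  obtain w where w: "Poly_Mapping.keys w \<subseteq> S" "\<And>\<beta>. \<beta> \<in> S \<Longrightarrow> riesz z ((q - w) * xpow \<beta>) = 0"
    using insert.IH[OF S insert.prems(2)] by auto
  obtain w1 where w1: "Poly_Mapping.keys w1 \<subseteq> S"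
    "\<And>\<beta>. \<beta> \<in> S \<Longrightarrow> riesz z ((xpow \<alpha> - w1) * xpow \<beta>) = 0"
    using insert.IH[OF S \<alpha>] by auto
  define \<epsilon> where "\<epsilon> = xpow \<alpha> - w1"
  have wd: "w \<in> polys_le d" "w1 \<in> polys_le d"
    using w(1) w1(1) insert.prems by (auto simp: keys_polys_le)
  then have ed: "\<epsilon> \<in> polys_le d" using \<alpha> by (auto simp: \<epsilon>_def intro: polys_le_diff)
  have qw: "riesz z ((q - w) * w1) = 0"
    by (rule riesz_test_monomials) (use w(2) w1(1) in blast)
  have ew: "riesz z (\<epsilon> * w1) = 0"
    unfolding \<epsilon>_def by (rule riesz_test_monomials) (use w1 in blast)
  have xa: "xpow \<alpha> = \<epsilon> + w1" by (simp add: \<epsilon>_def)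
  define t where "t = riesz z ((q - w) * \<epsilon>) / riesz z (\<epsilon> * \<epsilon>)"
  let ?w = "w + cst t * \<epsilon>"
  have w': "(q - ?w) * g = (q - w) * g - cst t * (\<epsilon> * g)" for g by (simp add: algebra_simps)
  have "riesz z ((q - w) * \<epsilon>) = t * riesz z (\<epsilon> * \<epsilon>)"
  proof (cases "riesz z (\<epsilon> * \<epsilon>) = 0")
    case True
    have "riesz z (\<epsilon> * (q - w)) = 0"
      by (rule null_space_mult[OF null_spaceI[OF pos ed True]])
        (use insert.prems wd in \<open>auto intro: polys_le_diff\<close>)
    then show ?thesis using True by (simp add: mult.commute)
  qed (simp add: t_def)
  then have "riesz z ((q - ?w) * xpow \<alpha>) = 0"
    using qw ew by (simp only: w' xa distrib_left riesz_diff riesz_add riesz_cst_mult)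
  moreover have "riesz z ((q - ?w) * xpow \<beta>) = 0" if "\<beta> \<in> S" for \<beta>
    using w(2)[OF that] w1(2)[OF that]
    by (simp only: w' riesz_diff[of z _ "cst t * _"] riesz_cst_mult) (simp add: \<epsilon>_def)
  moreover have "Poly_Mapping.keys ?w \<subseteq> insert \<alpha> S"
  proof -
    have "Poly_Mapping.keys \<epsilon> \<subseteq> insert \<alpha> S"
      using keys_diff[of "xpow \<alpha>" w1] w1(1) by (auto simp: \<epsilon>_def)
    then show ?thesis using keys_add[of w "cst t * \<epsilon>"] keys_cst_mult[of t \<epsilon>] w(1) by blast
  qed
  ultimately show ?case by (intro exI[of _ ?w]) auto
qed

lemma mono_list_append:
  assumes "i < num_monos TYPE('n::finite) e"
  shows "(mono_list (Suc e) ! i :: 'n mono) = mono_list e ! i"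
  using assms by (simp add: mono_list_Suc nth_append num_monos_def)

lemma mono_list_append_forms:
  "(mono_list (Suc e) ! (i + num_monos TYPE('n::finite) e) :: 'n mono) = forms_list (Suc e) ! i"
  "(mono_list (Suc e) ! (num_monos TYPE('n::finite) e + i) :: 'n mono) = forms_list (Suc e) ! i"
  by (simp_all add: mono_list_Suc nth_append num_monos_def)

lemma num_monos_Suc:
  "num_monos TYPE('n::finite) (Suc e) = num_monos TYPE('n) e + num_forms TYPE('n) (Suc e)"
  by (simp add: num_monos_def num_forms_def mono_list_Suc)

lemma forms_list_deg: "i < num_forms TYPE('n::finite) k \<Longrightarrow> mono_deg (forms_list k ! i :: 'n mono) = k"
  using nth_mem[of i "forms_list k :: 'n mono list"] by (simp add: num_forms_def forms_list)

lemma forms_list_index: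
  assumes "mono_deg (\<alpha> :: 'n::finite mono) = k"
  obtains i where "i < num_forms TYPE('n) k" "forms_list k ! i = \<alpha>"
  using assms forms_list(2)[of k, where 'n = 'n]
  by (metis (mono_tags, lifting) in_set_conv_nth mem_Collect_eq num_forms_def)

lemma block_B_eq:
  fixes y :: "'n::finite mono \<Rightarrow> real"
  shows "block_B (Suc e) y = mat (num_monos TYPE('n) e) (num_forms TYPE('n) (Suc e))
    (\<lambda>(i, j). y (mono_list e ! i + forms_list (Suc e) ! j))"
  by (rule eq_matI) (auto simp: block_B_def moment_blocks_def split_block_def Let_def
    moment_matrix_def num_monos_Suc mono_list_append mono_list_append_forms)

text \<open>
  The columns of \<open>W\<close> are the coefficients of the orthogonal projections of the monomials of degree \<open>e + 1\<close>
  onto the polynomials of degree at most \<open>e\<close>; orthogonality is the equation for the upper right block.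
\<close>

lemma positive_on_imp_is_block_W:
  fixes y :: "'n::finite mono \<Rightarrow> real"
  assumes pos: "positive_on (Suc e) y"
  shows "\<exists>W. is_block_W (Suc e) y W"
proof -
  let ?s = "num_monos TYPE('n) e" and ?r = "num_forms TYPE('n) (Suc e)"
  have "\<exists>w. w \<in> polys_le e \<and> (\<forall>\<alpha>. mono_deg \<alpha> \<le> e \<longrightarrow> riesz y ((xpow \<beta> - w) * xpow \<alpha>) = 0)"
    if "mono_deg \<beta> \<le> Suc e" for \<beta>
    using orthogonal_projection[OF pos, of "{\<alpha>. mono_deg \<alpha> \<le> e}" "xpow \<beta>"] that
    by (force simp: finite_mono_deg_le keys_polys_le polys_le_xpow)
  then obtain w where w: "\<And>\<beta>. mono_deg \<beta> \<le> Suc e \<Longrightarrow> w \<beta> \<in> polys_le e"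
    "\<And>\<alpha> \<beta>. mono_deg \<beta> \<le> Suc e \<Longrightarrow> mono_deg \<alpha> \<le> e \<Longrightarrow> riesz y ((xpow \<beta> - w \<beta>) * xpow \<alpha>) = 0"
    by metis
  define W where "W = mat ?s ?r (\<lambda>(i, j).
    Poly_Mapping.lookup (w (forms_list (Suc e) ! j)) (mono_list e ! i))"
  have "block_B (Suc e) y = moment_matrix e y * W"
  proof (rule eq_matI)
    fix i j assume "i < dim_row (moment_matrix e y * W)" "j < dim_col (moment_matrix e y * W)"
    then have ij: "i < ?s" "j < ?r" by (auto simp: moment_matrix_def W_def)
    let ?\<alpha> = "mono_list e ! i :: 'n mono" and ?\<beta> = "forms_list (Suc e) ! j :: 'n mono"
    have deg: "mono_deg ?\<alpha> \<le> e" "mono_deg ?\<beta> \<le> Suc e"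
      using ij mono_list_nth_deg forms_list_deg by (auto simp: order_eq_iff)
    have "col W j = coeff_vec e (w ?\<beta>)" using ij by (auto simp: W_def coeff_vec_def)
    then have "(moment_matrix e y * W) $$ (i, j) = (moment_matrix e y *\<^sub>v coeff_vec e (w ?\<beta>)) $ i"
      using ij by (simp add: moment_matrix_def W_def)
    also have "\<dots> = riesz y (xpow ?\<alpha> * w ?\<beta>)"
      using ij by (simp add: moment_matrix_mult_coeff_vec[OF w(1)[OF deg(2)]])
    also have "\<dots> = riesz y (xpow ?\<alpha> * xpow ?\<beta>)"
      using w(2)[OF deg(2,1)] by (simp add: algebra_simps riesz_diff)
    also have "\<dots> = block_B (Suc e) y $$ (i, j)"
      using ij by (simp add: block_B_eq mult_single)
    finally show "block_B (Suc e) y $$ (i, j) = (moment_matrix e y * W) $$ (i, j)" by simp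
  qed (auto simp: block_B_eq W_def moment_matrix_def)
  then have "is_block_W (Suc e) y W"
    by (simp add: is_block_W_def block_A_eq W_def)
  then show ?thesis by blast
qed

text \<open>
  The two vectors agree in degree at most \<open>2 d - 1\<close> because the modification changes only the lower right
  block. For flatness, let \<open>w j\<close> be the polynomial whose coefficients are column \<open>j\<close> of \<open>W\<close>. In both block rows
  the right block is the left block times \<open>W\<close>; this says that the \<open>j\<close>-th monomial of degree \<open>d\<close> minus
  \<open>w j\<close> is in the radical of the form given by \<open>z\<close>. Positivity then reduces to degree at most \<open>d - 1\<close>,
  where \<open>z\<close> may be replaced by \<open>y\<close>.
\<close>

lemma hankel_modified_moment_matrix:
  fixes y z :: "'n::finite mono \<Rightarrow> real"
  assumes pos: "positive_on (Suc e) y"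
    and M: "modified_moment_matrix (Suc e) y = moment_matrix (Suc e) z"
  shows "mono_deg \<alpha> \<le> 2 * Suc e - 1 \<Longrightarrow> z \<alpha> = y \<alpha>" and "flat_functional e z"
proof -
  let ?s = "num_monos TYPE('n) e" and ?r = "num_forms TYPE('n) (Suc e)"
  obtain W where W: "is_block_W (Suc e) y W" using positive_on_imp_is_block_W[OF pos] by blast
  let ?A = "moment_matrix e y"
  have Wc: "W \<in> carrier_mat ?s ?r" and B: "block_B (Suc e) y = ?A * W"
    using W by (auto simp: is_block_W_def block_A_eq)
  have M': "moment_matrix (Suc e) z = four_block_mat ?A (?A * W) (transpose_mat W * ?A) (transpose_mat W * ?A * W)"
    using modified_moment_matrix_eq[OF _ W] M by (simp add: block_A_eq)
  have entry: "z (mono_list (Suc e) ! i + mono_list (Suc e) ! j) =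
      four_block_mat ?A (?A * W) (transpose_mat W * ?A) (transpose_mat W * ?A * W) $$ (i, j)"
    if "i < ?s + ?r" "j < ?s + ?r" for i j
    using that unfolding M'[symmetric] by (simp add: moment_matrix_def num_monos_Suc)
  have z1: "z (mono_list e ! i + mono_list e ! j) = y (mono_list e ! i + mono_list e ! j)"
    if "i < ?s" "j < ?s" for i j
    using entry[of i j] that Wc
    by (simp add: mono_list_append moment_matrix_def)
  have z2: "z (mono_list e ! i + forms_list (Suc e) ! j) = (?A * W) $$ (i, j)"
    if "i < ?s" "j < ?r" for i j
    using entry[of i "?s + j"] that Wc
    by (simp add: mono_list_append mono_list_append_forms moment_matrix_def)
  have z3: "z (forms_list (Suc e) ! i + mono_list e ! j) = (transpose_mat W * ?A) $$ (i, j)"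
    if "i < ?r" "j < ?s" for i j
    using entry[of "?s + i" j] that Wc
    by (simp add: mono_list_append mono_list_append_forms moment_matrix_def)
  have z4: "z (forms_list (Suc e) ! i + forms_list (Suc e) ! j) = (transpose_mat W * ?A * W) $$ (i, j)"
    if "i < ?r" "j < ?r" for i j
    using entry[of "?s + i" "?s + j"] that Wc
    by (simp add: mono_list_append mono_list_append_forms moment_matrix_def)
  have agree_e: "z (\<alpha> + \<beta>) = y (\<alpha> + \<beta>)" if "mono_deg \<alpha> \<le> e" "mono_deg \<beta> \<le> e" for \<alpha> \<beta>
    using that z1 by (metis mono_list_index)
  have agree: "z (\<alpha> + \<beta>) = y (\<alpha> + \<beta>)" if \<alpha>: "mono_deg \<alpha> \<le> e" and \<beta>: "mono_deg \<beta> \<le> Suc e" for \<alpha> \<beta>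
  proof (cases "mono_deg \<beta> \<le> e")
    case False
    with \<beta> have "mono_deg \<beta> = Suc e" by simp
    then obtain j where j: "j < ?r" "forms_list (Suc e) ! j = \<beta>" by (rule forms_list_index)
    obtain i where i: "i < ?s" "mono_list e ! i = \<alpha>" using \<alpha> by (rule mono_list_index)
    have "z (\<alpha> + \<beta>) = block_B (Suc e) y $$ (i, j)" using z2[OF i(1) j(1)] i j B by simp
    then show ?thesis using i j by (simp add: block_B_eq)
  qed (use \<alpha> agree_e in auto)
  show "z \<alpha> = y \<alpha>" if \<alpha>: "mono_deg \<alpha> \<le> 2 * Suc e - 1"
  proof -
    have "mono_deg \<alpha> \<le> e + Suc e" using \<alpha> by simp
    then show ?thesis using mono_split_deg[of \<alpha> e "Suc e"] agree by blast
  qed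
  define w :: "nat \<Rightarrow> 'n rpoly" where
    "w j = (\<Sum>k = 0..<?s. cst (W $$ (k, j)) * xpow (mono_list e ! k))" for j
  have w_le: "w j \<in> polys_le e" for j
    unfolding w_def by (intro polys_le_sum polys_le_cst_mult polys_le_xpow) (auto simp: mono_list_nth_deg)
  have riesz_w: "riesz z (xpow \<gamma> * w j) = (\<Sum>k = 0..<?s. z (\<gamma> + mono_list e ! k) * W $$ (k, j))" for \<gamma> j
  proof -
    have "xpow \<gamma> * w j = (\<Sum>k = 0..<?s. cst (W $$ (k, j)) * xpow (\<gamma> + mono_list e ! k))"
      by (simp add: w_def sum_distrib_left mult_single)
    then show ?thesis by (simp only: riesz_sum riesz_cst_mult riesz_xpow mult.commute)
  qed
  have column: "z (\<gamma> + forms_list (Suc e) ! j) = riesz z (xpow \<gamma> * w j)"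
    if \<gamma>: "mono_deg \<gamma> \<le> Suc e" and j: "j < ?r" for \<gamma> j
  proof (cases "mono_deg \<gamma> \<le> e")
    case True
    then obtain i where i: "i < ?s" "mono_list e ! i = \<gamma>" by (rule mono_list_index)
    have "z (\<gamma> + forms_list (Suc e) ! j) = (\<Sum>k = 0..<?s. y (\<gamma> + mono_list e ! k) * W $$ (k, j))"
      using z2[OF i(1) j] i j Wc by (simp add: scalar_prod_def moment_matrix_def)
    also have "\<dots> = riesz z (xpow \<gamma> * w j)"
      using z1[OF i(1)] i by (simp add: riesz_w)
    finally show ?thesis .
  next
    case False
    with \<gamma> have "mono_deg \<gamma> = Suc e" by simp
    then obtain i where i: "i < ?r" "forms_list (Suc e) ! i = \<gamma>" by (rule forms_list_index)
    have "z (\<gamma> + forms_list (Suc e) ! j) = (transpose_mat W * ?A * W) $$ (i, j)"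
      using z4[OF i(1) j] i by simp
    also have "\<dots> = (\<Sum>k = 0..<?s. (transpose_mat W * ?A) $$ (i, k) * W $$ (k, j))"
      using i j Wc by (subst index_mult_mat) (auto simp: scalar_prod_def moment_matrix_def)
    also have "\<dots> = riesz z (xpow \<gamma> * w j)"
      unfolding riesz_w by (rule sum.cong) (use z3[OF i(1)] i in auto)
    finally show ?thesis .
  qed
  have null: "xpow (forms_list (Suc e) ! j) - w j \<in> null_space (Suc e) z" if j: "j < ?r" for j
    unfolding null_space_def
  proof (intro CollectI conjI ballI)
    show "xpow (forms_list (Suc e) ! j) - w j \<in> polys_le (Suc e)"
      using forms_list_deg[OF j] w_le
      by (intro polys_le_diff polys_le_xpow) (auto intro: polys_le_SucI)
    fix q :: "'n rpoly" assume q: "q \<in> polys_le (Suc e)"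
    show "riesz z ((xpow (forms_list (Suc e) ! j) - w j) * q) = 0"
    proof (rule riesz_test_monomials)
      fix \<gamma> assume "\<gamma> \<in> Poly_Mapping.keys q"
      then have "mono_deg \<gamma> \<le> Suc e" using q by (auto simp: polys_le_def)
      from column[OF this j]
      show "riesz z ((xpow (forms_list (Suc e) ! j) - w j) * xpow \<gamma>) = 0"
        by (simp add: left_diff_distrib riesz_diff mult_single mult.commute[of "w j"] add.commute)
    qed
  qed
  have red: "\<exists>p'. p' \<in> polys_le e \<and> xpow \<alpha> - p' \<in> null_space (Suc e) z"
    if "mono_deg \<alpha> \<le> Suc e" for \<alpha>
  proof (cases "mono_deg \<alpha> \<le> e")
    case True
    then show ?thesis by (intro exI[of _ "xpow \<alpha>"]) (simp add: polys_le_xpow)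
  next
    case False
    with that have "mono_deg \<alpha> = Suc e" by simp
    then obtain j where "j < ?r" "forms_list (Suc e) ! j = \<alpha>" by (rule forms_list_index)
    with null w_le show ?thesis by metis
  qed
  then obtain R where R: "\<And>\<alpha>. mono_deg \<alpha> \<le> Suc e \<Longrightarrow> R \<alpha> \<in> polys_le e"
    "\<And>\<alpha>. mono_deg \<alpha> \<le> Suc e \<Longrightarrow> xpow \<alpha> - R \<alpha> \<in> null_space (Suc e) z" by metis
  have flat: "\<exists>p'\<in>polys_le e. p - p' \<in> null_space (Suc e) z" if p: "p \<in> polys_le (Suc e)" for p
  proof -
    let ?K = "Poly_Mapping.keys p" and ?c = "Poly_Mapping.lookup p"
    let ?p' = "\<Sum>\<alpha>\<in>?K. cst (?c \<alpha>) * R \<alpha>"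
    have deg: "mono_deg \<alpha> \<le> Suc e" if "\<alpha> \<in> ?K" for \<alpha> using p that by (auto simp: polys_le_def)
    have "p - ?p' = (\<Sum>\<alpha>\<in>?K. cst (?c \<alpha>) * xpow \<alpha>) - ?p'"
      using rpoly_expand[of ?K p] by simp
    also have "\<dots> = (\<Sum>\<alpha>\<in>?K. cst (?c \<alpha>) * (xpow \<alpha> - R \<alpha>))"
      by (simp only: sum_subtractf right_diff_distrib)
    also have "\<dots> \<in> null_space (Suc e) z"
      by (intro null_space_sum null_space_cst_mult R(2) deg)
    finally show ?thesis
      by (intro bexI[of _ ?p']) (auto intro: polys_le_sum polys_le_cst_mult R(1) deg)
  qed
  have "positive_on (Suc e) z"
    unfolding positive_on_def
  proof
    fix p :: "'n rpoly" assume p: "p \<in> polys_le (Suc e)"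
    obtain p' where p': "p' \<in> polys_le e" "p - p' \<in> null_space (Suc e) z" using flat[OF p] by blast
    \<comment> \<open>Changing \<open>p\<close> by an element of the radical does not change \<open>L(p\<^sup>2)\<close>.\<close>
    have "riesz z ((p - p') * p) = 0" "riesz z ((p - p') * p') = 0"
      using p p' by (auto intro!: null_space_mult polys_le_SucI)
    then have "riesz z (p * p) = riesz z (p' * p')"
      by (simp add: algebra_simps riesz_diff)
    also have "\<dots> = riesz y (p' * p')"
    proof -
      let ?S = "{\<alpha> :: 'n mono. mono_deg \<alpha> \<le> e}"
      have "riesz x (p' * p') = (\<Sum>\<alpha>\<in>?S. \<Sum>\<beta>\<in>?S.
          Poly_Mapping.lookup p' \<alpha> * Poly_Mapping.lookup p' \<beta> * x (\<alpha> + \<beta>))" for x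
        by (rule riesz_mult_expand) (use p'(1) in \<open>auto simp: finite_mono_deg_le keys_polys_le\<close>)
      then show ?thesis using agree_e by simp
    qed
    also have "\<dots> \<ge> 0" using pos polys_le_SucI[OF p'(1)] by (auto simp: positive_on_def)
    finally show "0 \<le> riesz z (p * p)" .
  qed
  with flat show "flat_functional e z" by unfold_locales auto
qed

section \<open>Atomic matrices and optimality of the atoms\<close>

lemma finsum_module_mat:
  fixes F :: "'i \<Rightarrow> real mat"
  assumes "finite I" "\<And>k. k \<in> I \<Longrightarrow> F k \<in> carrier_mat n m"
  shows "finsum (module_mat TYPE(real) n m) F I \<in> carrier_mat n m \<and>
    (\<forall>i<n. \<forall>j<m. finsum (module_mat TYPE(real) n m) F I $$ (i, j) = (\<Sum>k\<in>I. F k $$ (i, j)))"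
  using assms
proof (induction I rule: finite_induct)
  interpret vectorspace class_ring "module_mat TYPE(real) n m" by (rule matrix_vs)
  {
    case empty
    show ?case by (simp add: module_mat_simps)
  next
    case (insert k I)
    have "finsum (module_mat TYPE(real) n m) F (insert k I) =
        F k + finsum (module_mat TYPE(real) n m) F I"
      using insert.hyps insert.prems by (subst finsum_insert) (auto simp: module_mat_simps)
    with insert show ?case by auto
  }
qed

lemma atomic_matrix_eq:
  fixes a :: "nat \<Rightarrow> real ^ 'n::finite"
  shows "atomic_matrix d r l a = moment_matrix d (\<lambda>\<alpha>. \<Sum>k = 1..r. l k * mono_eval \<alpha> (a k))"
proof -
  let ?n = "num_monos TYPE('n) d"
  let ?F = "\<lambda>k. l k \<cdot>\<^sub>m (mono_col d (a k) * transpose_mat (mono_col d (a k)))"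
  have carr: "?F k \<in> carrier_mat ?n ?n" for k
    by (intro smult_carrier_mat mult_carrier_mat[where n = 1]) (auto simp: mono_col_def)
  have entry: "?F k $$ (i, j) = l k * mono_eval (mono_list d ! i + mono_list d ! j) (a k)"
    if "i < ?n" "j < ?n" for k i j
    using that by (simp add: mono_col_def mono_eval_add scalar_prod_def)
  have "atomic_matrix d r l a \<in> carrier_mat ?n ?n"
    "\<And>i j. i < ?n \<Longrightarrow> j < ?n \<Longrightarrow> atomic_matrix d r l a $$ (i, j) = (\<Sum>k = 1..r. ?F k $$ (i, j))"
    using finsum_module_mat[of "{1..r}" ?F ?n ?n] carr by (auto simp: atomic_matrix_def)
  then show ?thesis
    by (intro eq_matI) (auto simp: moment_matrix_def entry)
qed

lemma moment_matrix_eq_iff: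
  fixes z z' :: "'n::finite mono \<Rightarrow> real"
  shows "moment_matrix d z = moment_matrix d z' \<longleftrightarrow> (\<forall>\<alpha>. mono_deg \<alpha> \<le> 2 * d \<longrightarrow> z \<alpha> = z' \<alpha>)"
proof safe
  fix \<alpha> :: "'n mono"
  assume eq: "moment_matrix d z = moment_matrix d z'" and "mono_deg \<alpha> \<le> 2 * d"
  then have "mono_deg \<alpha> \<le> d + d" by simp
  then obtain \<beta> \<gamma> where \<alpha>: "\<alpha> = \<beta> + \<gamma>" "mono_deg \<beta> \<le> d" "mono_deg \<gamma> \<le> d"
    using mono_split_deg by blast
  obtain i where i: "i < num_monos TYPE('n) d" "mono_list d ! i = \<beta>" using \<alpha>(2) by (rule mono_list_index)
  obtain j where j: "j < num_monos TYPE('n) d" "mono_list d ! j = \<gamma>" using \<alpha>(3) by (rule mono_list_index)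
  have "moment_matrix d z $$ (i, j) = moment_matrix d z' $$ (i, j)" by (simp add: eq)
  then show "z \<alpha> = z' \<alpha>" using i j by (simp add: moment_matrix_def \<alpha>)
next
  assume "\<forall>\<alpha>. mono_deg \<alpha> \<le> 2 * d \<longrightarrow> z \<alpha> = z' \<alpha>"
  moreover have "mono_deg (mono_list d ! i + mono_list d ! j :: 'n mono) \<le> 2 * d"
    if "i < num_monos TYPE('n) d" "j < num_monos TYPE('n) d" for i j
    using mono_list_nth_deg[OF that(1)] mono_list_nth_deg[OF that(2)] by simp
  ultimately show "moment_matrix d z = moment_matrix d z'"
    by (intro eq_matI) (auto simp: moment_matrix_def)
qed

lemma psd_rank_one:
  assumes "0 \<le> c"
  shows "psd (mat n n (\<lambda>(i, j). c * g i * g j))"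
proof -
  let ?A = "mat n n (\<lambda>(i, j). c * g i * g j)"
  have "v \<bullet> (?A *\<^sub>v v) = c * (\<Sum>i = 0..<n. g i * v $ i)\<^sup>2" if v: "v \<in> carrier_vec n" for v
    using v by (simp add: scalar_prod_def power2_eq_square sum_product sum_distrib_left mult_ac)
  then show ?thesis
    using assms by (auto simp: psd_def intro!: eq_matI)
qed

text \<open>
  It is the rank one matrix \<open>p(x) V(x) V(x)\<^sup>T\<close>.
\<close>

lemma localizing_matrix_point:
  fixes x :: "real ^ 'n::finite"
  assumes "0 \<le> rpoly_eval p x"
  shows "psd (localizing_matrix k p (\<lambda>\<alpha>. mono_eval \<alpha> x))"
proof -
  have "localizing_matrix k p (\<lambda>\<alpha>. mono_eval \<alpha> x) =
      mat (num_monos TYPE('n) (loc_order k p)) (num_monos TYPE('n) (loc_order k p))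
       (\<lambda>(i, j). rpoly_eval p x * mono_eval (mono_list (loc_order k p) ! i) x *
          mono_eval (mono_list (loc_order k p) ! j) x)"
    by (rule eq_matI)
      (auto simp: localizing_matrix_def rpoly_eval_def mono_eval_add sum_distrib_left sum_distrib_right mult_ac)
  then show ?thesis using psd_rank_one[OF assms] by simp
qed

lemma relax_feasible_point:
  assumes "x \<in> feasible_set m p"
  shows "relax_feasible k m p (\<lambda>\<alpha>. mono_eval \<alpha> x)"
proof -
  have "rpoly_eval 1 x = 1" by (simp add: rpoly_eval_def)
  then show ?thesis
    using assms by (auto simp: relax_feasible_def feasible_set_def intro!: localizing_matrix_point)
qed

lemma total_deg_polys_le: "total_deg p \<le> k \<Longrightarrow> p \<in> polys_le k"
  by (auto simp: total_deg_def polys_le_def split: if_splits)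

lemma relax_objective_eq_riesz: "f \<in> polys_le k \<Longrightarrow> relax_objective k f y = riesz y f"
  using riesz_superset[of "{\<alpha>. mono_deg \<alpha> \<le> k}" f y]
  by (simp add: relax_objective_def finite_mono_deg_le keys_polys_le)

lemma relax_opt_value_optimal:
  assumes "relax_optimal_solution k f m p y"
  shows "relax_opt_value k f m p = ereal (relax_objective k f y)"
  unfolding relax_opt_value_def
  using assms by (intro antisym INF_lower INF_greatest) (auto simp: relax_optimal_solution_def)

lemma riesz_sum_point_evaluations:
  assumes "f \<in> polys_le k"
    and "\<And>\<alpha>. mono_deg \<alpha> \<le> k \<Longrightarrow> y \<alpha> = (\<Sum>i\<in>I. l i * mono_eval \<alpha> (a i))"
  shows "riesz y f = (\<Sum>i\<in>I. l i * rpoly_eval f (a i))"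
proof -
  have "riesz y f = (\<Sum>\<alpha>\<in>Poly_Mapping.keys f. \<Sum>i\<in>I. l i * (Poly_Mapping.lookup f \<alpha> * mono_eval \<alpha> (a i)))"
    using assms by (simp add: riesz_def polys_le_def sum_distrib_left mult_ac)
  also have "\<dots> = (\<Sum>i\<in>I. l i * rpoly_eval f (a i))"
    by (subst sum.swap) (simp add: rpoly_eval_def sum_distrib_left)
  finally show ?thesis .
qed

text \<open>
  Averaging: all values \<open>f(a\<^sub>i)\<close> are at least the optimal value \<open>v\<close> of the relaxation, their weighted average
  is \<open>v\<close> and the weights are positive, so each of them equals \<open>v\<close>. The degree \<open>j\<close> up to which \<open>y\<close> is
  represented by the atoms only has to cover \<open>f\<close>.
\<close>

lemma atoms_global_minimizers:
  fixes a :: "'i \<Rightarrow> real ^ 'n::finite"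
  assumes opt: "relax_optimal_solution k f m p y" and f: "f \<in> polys_le j" "j \<le> k"
    and y: "\<And>\<alpha>. mono_deg \<alpha> \<le> j \<Longrightarrow> y \<alpha> = (\<Sum>i\<in>I. l i * mono_eval \<alpha> (a i))"
    and I: "finite I" and l: "\<And>i. i \<in> I \<Longrightarrow> l i > 0" and a: "a ` I \<subseteq> feasible_set m p"
  shows "\<And>i. i \<in> I \<Longrightarrow> global_minimizer f m p (a i)"
    and "opt_value f m p = relax_opt_value k f m p"
    and "\<And>i. i \<in> I \<Longrightarrow> relax_opt_value k f m p = ereal (rpoly_eval f (a i))"
proof -
  define v where "v = relax_objective k f y"
  have fk: "f \<in> polys_le k" using f by (rule polys_le_mono)
  have lower: "v \<le> rpoly_eval f x" if x: "x \<in> feasible_set m p" for x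
  proof -
    have "v \<le> relax_objective k f (\<lambda>\<alpha>. mono_eval \<alpha> x)"
      using opt relax_feasible_point[OF x] by (simp add: relax_optimal_solution_def v_def)
    then show ?thesis by (simp add: relax_objective_eq_riesz[OF fk] rpoly_eval_eq_riesz)
  qed
  have "y 0 = 1" using opt by (simp add: relax_optimal_solution_def relax_feasible_def)
  then have l1: "(\<Sum>i\<in>I. l i) = 1" using y[of 0] by simp
  have "v = (\<Sum>i\<in>I. l i * rpoly_eval f (a i))"
    unfolding v_def relax_objective_eq_riesz[OF fk] by (rule riesz_sum_point_evaluations[OF f(1) y])
  then have "(\<Sum>i\<in>I. l i * (rpoly_eval f (a i) - v)) = 0"
    using l1 by (simp add: right_diff_distrib sum_subtractf sum_distrib_right[symmetric])
  moreover have "0 \<le> l i * (rpoly_eval f (a i) - v)" if "i \<in> I" for i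
    using l[OF that] lower a that by (intro mult_nonneg_nonneg) (auto intro: less_imp_le)
  ultimately have "\<forall>i\<in>I. l i * (rpoly_eval f (a i) - v) = 0"
    using I by (simp add: sum_nonneg_eq_0_iff)
  then have val: "rpoly_eval f (a i) = v" if "i \<in> I" for i
    using l that by fastforce
  have rel: "relax_opt_value k f m p = ereal v"
    unfolding v_def by (rule relax_opt_value_optimal[OF opt])
  show "global_minimizer f m p (a i)" if "i \<in> I" for i
    using that a lower val by (auto simp: global_minimizer_def)
  show "relax_opt_value k f m p = ereal (rpoly_eval f (a i))" if "i \<in> I" for i
    using rel val[OF that] by simp
  have "I \<noteq> {}" using l1 by auto
  then obtain i where i: "i \<in> I" by blast
  have "opt_value f m p = ereal v"
    unfolding opt_value_def
  proof (rule antisym)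
    show "(INF x\<in>feasible_set m p. ereal (rpoly_eval f x)) \<le> ereal v"
      using INF_lower[of "a i" "feasible_set m p" "\<lambda>x. ereal (rpoly_eval f x)"] a i val by auto
    show "ereal v \<le> (INF x\<in>feasible_set m p. ereal (rpoly_eval f x))"
      by (rule INF_greatest) (simp add: lower)
  qed
  with rel show "opt_value f m p = relax_opt_value k f m p" by simp
qed

theorem theorem2p7:
  fixes d m :: nat
    and f :: "'n::finite rpoly"
    and p :: "nat \<Rightarrow> 'n rpoly"
    and y :: "'n mono \<Rightarrow> real"
    and r :: nat
  defines "r \<equiv> vec_space.rank (num_monos TYPE('n) (d - 1)) (block_A d y)"
  assumes "d \<ge> 1"
    and "total_deg f \<le> 2 * d"
    and "\<forall>i\<in>{1..m}. total_deg (p i) \<le> 2 * d"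
    and "relax_optimal_solution (2 * d) f m p y"
    and "generalized_hankel TYPE('n) d (modified_moment_matrix d y)"
  shows "(\<exists>(a :: nat \<Rightarrow> real ^ 'n) l. (\<forall>i\<in>{1..r}. l i > 0) \<and>
           modified_moment_matrix d y = atomic_matrix d r l a) \<and>
         (\<forall>(a :: nat \<Rightarrow> real ^ 'n) l. (\<forall>i\<in>{1..r}. l i > 0) \<and>
             modified_moment_matrix d y = atomic_matrix d r l a \<and>
             a ` {1..r} \<subseteq> feasible_set m p \<and> total_deg f \<le> 2 * d - 1 \<longrightarrow>
           (\<forall>i\<in>{1..r}. global_minimizer f m p (a i)) \<and>
           opt_value f m p = relax_opt_value (2 * d) f m p \<and>
           (\<forall>i\<in>{1..r}. relax_opt_value (2 * d) f m p = ereal (rpoly_eval f (a i))))"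
proof -
  from \<open>d \<ge> 1\<close> obtain e where d: "d = Suc e" by (cases d) auto
  note opt = \<open>relax_optimal_solution (2 * d) f m p y\<close>
  have "psd (moment_matrix d y)"
    using opt by (simp add: relax_optimal_solution_def relax_feasible_def localizing_matrix_one)
  then have pos: "positive_on (Suc e) y"
    unfolding d by (rule psd_moment_matrix_imp_positive_on)
  obtain z :: "'n mono \<Rightarrow> real" where z: "modified_moment_matrix d y = moment_matrix d z"
    using \<open>generalized_hankel TYPE('n) d (modified_moment_matrix d y)\<close>
    by (auto simp: generalized_hankel_def)
  have zy: "z \<alpha> = y \<alpha>" if "mono_deg \<alpha> \<le> 2 * d - 1" for \<alpha>
    using hankel_modified_moment_matrix(1)[OF pos] z that unfolding d by blast
  have flat: "flat_functional e z"
    using hankel_modified_moment_matrix(2)[OF pos] z unfolding d by blast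
  have "moment_matrix e z = moment_matrix e y"
    unfolding moment_matrix_eq_iff using zy by (auto simp: d)
  then have r: "r = vec_space.rank (num_monos TYPE('n) e) (moment_matrix e z)"
    unfolding r_def d by (simp add: block_A_eq)
  have atomic_iff: "modified_moment_matrix d y = atomic_matrix d r l a \<longleftrightarrow>
      (\<forall>\<alpha>. mono_deg \<alpha> \<le> 2 * d \<longrightarrow> z \<alpha> = (\<Sum>i = 1..r. l i * mono_eval \<alpha> (a i)))"
    for l and a :: "nat \<Rightarrow> real ^ 'n"
    unfolding z atomic_matrix_eq by (rule moment_matrix_eq_iff)
  show ?thesis
  proof (rule conjI)
    show "\<exists>(a :: nat \<Rightarrow> real ^ 'n) l. (\<forall>i\<in>{1..r}. l i > 0) \<and>
        modified_moment_matrix d y = atomic_matrix d r l a"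
      unfolding atomic_iff unfolding d by (rule flat_functional_atomic[OF flat r])
    show "\<forall>(a :: nat \<Rightarrow> real ^ 'n) l. (\<forall>i\<in>{1..r}. l i > 0) \<and>
        modified_moment_matrix d y = atomic_matrix d r l a \<and>
        a ` {1..r} \<subseteq> feasible_set m p \<and> total_deg f \<le> 2 * d - 1 \<longrightarrow>
        (\<forall>i\<in>{1..r}. global_minimizer f m p (a i)) \<and>
        opt_value f m p = relax_opt_value (2 * d) f m p \<and>
        (\<forall>i\<in>{1..r}. relax_opt_value (2 * d) f m p = ereal (rpoly_eval f (a i)))"
    proof (intro allI impI, elim conjE)
      fix a :: "nat \<Rightarrow> real ^ 'n" and l
      assume l: "\<forall>i\<in>{1..r}. l i > 0" and at: "modified_moment_matrix d y = atomic_matrix d r l a"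
        and a: "a ` {1..r} \<subseteq> feasible_set m p" and f: "total_deg f \<le> 2 * d - 1"
      have "y \<alpha> = (\<Sum>i = 1..r. l i * mono_eval \<alpha> (a i))" if "mono_deg \<alpha> \<le> 2 * d - 1" for \<alpha>
        using at zy[OF that] that unfolding atomic_iff by simp
      from atoms_global_minimizers[OF opt total_deg_polys_le[OF f] _ this _ _ a] l
      show "(\<forall>i\<in>{1..r}. global_minimizer f m p (a i)) \<and>
          opt_value f m p = relax_opt_value (2 * d) f m p \<and>
          (\<forall>i\<in>{1..r}. relax_opt_value (2 * d) f m p = ereal (rpoly_eval f (a i)))"
        by simp
    qed
  qed
qed

end
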